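(* Let $M=(M^{AB})_{A,B=1}^4$ be a symmetric complex matrix, $Z_1,Z_2,Z_3,Z_4$ pairwise distinct complex numbers, $g\in\mathbb{C}$, and let $\chi_{1A},\chi_{2A},\chi_{4A},\tilde\chi_3^A\in\mathbb{C}$ ($A=1,\dots,4$). Let $$f_1=\Psi_1^A\chi_{1A},\qquad f_2=\Psi_2^A\chi_{2A},\qquad f_3=\tfrac16\epsilon_{ABCD}\Psi_3^A\Psi_3^B\Psi_3^C\tilde\chi_3^D,\qquad f_4=\Psi_4^A\chi_{4A}$$ be the external wavefunctions of particles of helicities $+\tfrac12,+\tfrac12,-\tfrac12,+\tfrac12$. Then the integral over the moduli of degree-one curves in the deformed super twistor space $$2ig^2\int\prod_{i=1}^4 d^4\Psi_i\int d^8\theta\ \prod_{i=1}^4\delta^4\!\Big(\Psi_i^A+\theta_1^A+\theta_2^AZ_i-\tfrac16M^{AB}\epsilon_{BCDE}\theta_2^C\theta_2^D\theta_2^EZ_i^2\Big)\frac{f_1f_2f_3f_4}{\prod_{i=1}^4\langle i,i+1\rangle}$$ equals $$\frac{2ig^2}{\prod_{i=1}^4\langle i,i+1\rangle}\Big\{\chi_{1A}M^{AB}\chi_{2B}\,\tilde\chi_3^C\chi_{4C}\,\langle1,2\rangle\langle2,3\rangle\langle3,1\rangle+\chi_{1A}\tilde\chi_3^A\,\chi_{2B}M^{BD}\chi_{4D}\,\langle2,4\rangle\langle2,3\rangle\langle3,4\rangle+\chi_{2B}\tilde\chi_3^B\,\chi_{1A}M^{AD}\chi_{4D}\,\langle4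,1\rangle\langle1,3\rangle\langle3,4\rangle\Big\}.$$
   Context: Repeated indices $A,B,\dots$ are summed over $1,\dots,4$; $\epsilon_{ABCD}$ is totally antisymmetric with $\epsilon_{1234}=1$. Spinors are scaled to $\lambda_i=(1,Z_i)$, so $\langle i,j\rangle=Z_j-Z_i$, and $\langle 4,5\rangle$ means $\langle4,1\rangle$. $\theta_1^A,\theta_2^A$ ($A=1,\dots,4$) are eight anticommuting Grassmann generators and $\Psi_i^A$ are further anticommuting variables. The fermionic delta functions are defined by $\int d^4\Psi\,\delta^4(\Psi^A-\Psi_0^A)f(\Psi)=f(\Psi_0)$, so the integrals over $\Psi_1,\dots,\Psi_4$ amount to substituting $\Psi_i^A=-\theta_1^A-\theta_2^AZ_i+\frac16M^{AB}\epsilon_{BCDE}\theta_2^C\theta_2^D\theta_2^EZ_i^2$ into the product $f_1f_2f_3f_4$ (taken in this order). The Berezin integral $\int d^8\theta$ picks out the coefficient of $\theta_1^1\theta_1^2\theta_1^3\theta_1^4\theta_2^1\theta_2^2\theta_2^3\theta_2^4$. *)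

theory Defs
  imports "HOL-Analysis.Analysis"
begin

section \<open>The complex Grassmann algebra on a finite ordered set of generators\<close>

text \<open>
  An element is given by its coefficients: \<open>coeff F {g\<^sub>1 < \<dots> < g\<^sub>n}\<close> is the coefficient of the
  monomial \<open>g\<^sub>1 \<cdots> g\<^sub>n\<close>.  The order on the generators only serves to fix the sign of the basis
  monomials.
\<close>

datatype 'g grassmann = Grassmann (coeff: "'g set \<Rightarrow> complex")

lemma grassmann_eqI: "(\<And>S. coeff F S = coeff G S) \<Longrightarrow> F = G"
  by (cases F; cases G) auto

text \<open>The number of transpositions needed to sort the product of two sorted monomials.\<close>

definition inversions :: "'g::{finite,linorder} set \<Rightarrow> 'g set \<Rightarrow> nat" where
  "inversions S T = card {(s, t). s \<in> S \<and> t \<in> T \<and> t < s}"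

instantiation grassmann :: ("{finite,linorder}") "{zero,one,plus,minus,uminus,times}"
begin

definition "0 = Grassmann (\<lambda>_. 0)"
definition "1 = Grassmann (\<lambda>S. if S = {} then 1 else 0)"
definition "F + G = Grassmann (\<lambda>S. coeff F S + coeff G S)"
definition "F - G = Grassmann (\<lambda>S. coeff F S - coeff G S)"
definition "- F = Grassmann (\<lambda>S. - coeff F S)"
definition "F * G =
  Grassmann (\<lambda>U. \<Sum>S\<in>Pow U. (- 1) ^ inversions S (U - S) * coeff F S * coeff G (U - S))"

instance ..

end

definition gconst :: "complex \<Rightarrow> 'g::{finite,linorder} grassmann" where
  "gconst c = Grassmann (\<lambda>S. if S = {} then c else 0)"

definition gen :: "'g::{finite,linorder} \<Rightarrow> 'g grassmann" where
  "gen g = Grassmann (\<lambda>S. if S = {g} then 1 else 0)"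

lemma coeff_simps [simp]:
  "coeff 0 S = 0"
  "coeff 1 S = (if S = {} then 1 else 0)"
  "coeff (F + G) S = coeff F S + coeff G S"
  "coeff (F - G) S = coeff F S - coeff G S"
  "coeff (- F) S = - coeff F S"
  "coeff (gconst c) S = (if S = {} then c else 0)"
  "coeff (gen g) S = (if S = {g} then 1 else 0)"
  by (simp_all add: zero_grassmann_def one_grassmann_def plus_grassmann_def
      minus_grassmann_def uminus_grassmann_def gconst_def gen_def)

lemma coeff_times:
  "coeff (F * G) U = (\<Sum>S\<in>Pow U. (- 1) ^ inversions S (U - S) * coeff F S * coeff G (U - S))"
  by (simp add: times_grassmann_def)

lemma inversions_Un_left:
  assumes "S \<inter> T = {}"
  shows "inversions (S \<union> T) V = inversions S V + inversions T V"
proof -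
  have "{(s, t). s \<in> S \<union> T \<and> t \<in> V \<and> t < s} =
        {(s, t). s \<in> S \<and> t \<in> V \<and> t < s} \<union> {(s, t). s \<in> T \<and> t \<in> V \<and> t < s}"
    by auto
  then show ?thesis
    unfolding inversions_def using assms by (simp only:) (subst card_Un_disjoint, auto)
qed

lemma inversions_Un_right:
  assumes "S \<inter> T = {}"
  shows "inversions V (S \<union> T) = inversions V S + inversions V T"
proof -
  have "{(s, t). s \<in> V \<and> t \<in> S \<union> T \<and> t < s} =
        {(s, t). s \<in> V \<and> t \<in> S \<and> t < s} \<union> {(s, t). s \<in> V \<and> t \<in> T \<and> t < s}"
    by auto
  then show ?thesis
    unfolding inversions_def using assms by (simp only:) (subst card_Un_disjoint, auto)
qed

lemma inversions_empty [simp]: "inversions {} T = 0" "inversions S {} = 0"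
  by (simp_all add: inversions_def)

lemma inversions_singleton_left: "inversions {g} T = card {t \<in> T. t < g}"
proof -
  have "{(s, t). s \<in> {g} \<and> t \<in> T \<and> t < s} = Pair g ` {t \<in> T. t < g}" by auto
  then show ?thesis by (simp add: inversions_def card_image inj_on_def)
qed

lemma inversions_singleton_right: "inversions S {g} = card {s \<in> S. g < s}"
proof -
  have "{(s, t). s \<in> S \<and> t \<in> {g} \<and> t < s} = (\<lambda>s. (s, g)) ` {s \<in> S. g < s}" by auto
  then show ?thesis by (simp add: inversions_def card_image inj_on_def)
qed

lemma inversions_commute:
  assumes "S \<inter> T = {}"
  shows "inversions S T + inversions T S = card S * card T"
proof -
  define A where "A = {(s, t). s \<in> S \<and> t \<in> T \<and> t < s}"
  define B where "B = {(s, t). s \<in> S \<and> t \<in> T \<and> s < t}"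
  have "{(s, t). s \<in> T \<and> t \<in> S \<and> t < s} = B\<inverse>"
    by (auto simp: B_def)
  then have B: "inversions T S = card B"
    unfolding inversions_def by (simp only: card_inverse)
  have A: "inversions S T = card A"
    by (simp add: inversions_def A_def)
  have "t < s \<or> s < t" if "s \<in> S" "t \<in> T" for s t
    using that assms by (metis disjoint_iff linorder_less_linear)
  then have ST: "S \<times> T = A \<union> B"
    by (auto simp: A_def B_def)
  have "card (A \<union> B) = card A + card B"
    by (rule card_Un_disjoint) (auto simp: A_def B_def)
  then show ?thesis
    by (simp only: A B ST[symmetric] card_cartesian_product)
qed

lemma grassmann_mult_assoc: "F * G * H = F * (G * (H :: 'g::{finite,linorder} grassmann))"
proof (rule grassmann_eqI)
  fix U :: "'g set"
  let ?t = "\<lambda>S T V. (- 1) ^ (inversions S T + inversions S V + inversions T V) *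
              coeff F S * coeff G T * coeff H V"
  have "coeff (F * G * H) U =
      (\<Sum>W\<in>Pow U. \<Sum>S\<in>Pow W. ?t S (W - S) (U - W))"
    unfolding coeff_times[of "F * G"]
  proof (rule sum.cong, simp)
    fix W assume "W \<in> Pow U"
    show "(- 1) ^ inversions W (U - W) * coeff (F * G) W * coeff H (U - W) =
      (\<Sum>S\<in>Pow W. ?t S (W - S) (U - W))"
      unfolding coeff_times sum_distrib_left sum_distrib_right
    proof (rule sum.cong, simp)
      fix S assume "S \<in> Pow W"
      then have "inversions W (U - W) = inversions S (U - W) + inversions (W - S) (U - W)"
        using inversions_Un_left[of S "W - S" "U - W"] by (simp add: Un_absorb1)
      then show "(- 1) ^ inversions W (U - W) *
           ((- 1) ^ inversions S (W - S) * coeff F S * coeff G (W - S)) * coeff H (U - W) =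
         ?t S (W - S) (U - W)"
        by (simp add: power_add mult_ac)
    qed
  qed
  also have "\<dots> = (\<Sum>(W, S)\<in>Sigma (Pow U) Pow. ?t S (W - S) (U - W))"
    by (subst sum.Sigma) auto
  also have "\<dots> = (\<Sum>(S, T)\<in>Sigma (Pow U) (\<lambda>S. Pow (U - S)). ?t S T (U - S - T))"
  proof (rule sum.reindex_bij_witness[where i = "\<lambda>(S, T). (S \<union> T, S)" and j = "\<lambda>(W, S). (S, W - S)"])
    fix WS assume WS: "WS \<in> Sigma (Pow U) Pow"
    obtain W S where "WS = (W, S)" by force
    moreover from this WS have "U - S - (W - S) = U - W" by auto
    ultimately show "(case case WS of (W, S) \<Rightarrow> (S, W - S) of (S, T) \<Rightarrow> ?t S T (U - S - T)) =
        (case WS of (W, S) \<Rightarrow> ?t S (W - S) (U - W))"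
      by simp
  qed auto
  also have "\<dots> = (\<Sum>S\<in>Pow U. \<Sum>T\<in>Pow (U - S). ?t S T (U - S - T))"
    by (subst sum.Sigma) auto
  also have "\<dots> = coeff (F * (G * H)) U"
    unfolding coeff_times[of F]
  proof (rule sum.cong, simp)
    fix S assume "S \<in> Pow U"
    show "(\<Sum>T\<in>Pow (U - S). ?t S T (U - S - T)) =
      (- 1) ^ inversions S (U - S) * coeff F S * coeff (G * H) (U - S)"
      unfolding coeff_times sum_distrib_left sum_distrib_right
    proof (rule sum.cong, simp)
      fix T assume "T \<in> Pow (U - S)"
      then have "inversions S (U - S) = inversions S T + inversions S (U - S - T)"
        using inversions_Un_right[of T "U - S - T" S] by (simp add: Un_absorb1)
      then show "?t S T (U - S - T) = (- 1) ^ inversions S (U - S) * coeff F S *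
           ((- 1) ^ inversions T (U - S - T) * coeff G T * coeff H (U - S - T))"
        by (simp add: power_add mult_ac)
    qed
  qed
  finally show "coeff (F * G * H) U = coeff (F * (G * H)) U" .
qed

lemma coeff_gconst_times: "coeff (gconst c * F) U = c * coeff F U"
proof -
  have "coeff (gconst c * F) U = (\<Sum>S\<in>Pow U. if S = {} then c * coeff F U else 0)"
    unfolding coeff_times by (intro sum.cong) auto
  then show ?thesis by simp
qed

lemma coeff_times_gconst: "coeff (F * gconst c) U = c * coeff F U"
proof -
  have "coeff (F * gconst c) U = (\<Sum>S\<in>Pow U. if S = U then c * coeff F U else 0)"
    unfolding coeff_times by (intro sum.cong) auto
  then show ?thesis by simp
qed

instance grassmann :: ("{finite,linorder}") ring_1
proof
  fix F G H :: "'a grassmann"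
  have one: "(1 :: 'a grassmann) = gconst 1" by (rule grassmann_eqI) simp
  show "F * G * H = F * (G * H)" by (rule grassmann_mult_assoc)
  show "1 * F = F" "F * 1 = F"
    by (rule grassmann_eqI, simp add: one coeff_gconst_times coeff_times_gconst)+
  show "(F + G) * H = F * H + G * H" "F * (G + H) = F * G + F * H"
    by (rule grassmann_eqI, simp add: coeff_times sum.distrib algebra_simps)+
  have "coeff 0 {} \<noteq> coeff (1 :: 'a grassmann) {}" by simp
  then show "(0 :: 'a grassmann) \<noteq> 1" by metis
qed (rule grassmann_eqI, simp)+

lemma gconst_simps:
  "gconst 0 = 0" "gconst 1 = 1" "gconst (a + b) = gconst a + gconst b"
  "gconst (a - b) = gconst a - gconst b" "gconst (- a) = - gconst a"
  "gconst (a * b) = gconst a * gconst b"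
  by (rule grassmann_eqI, simp add: coeff_gconst_times)+

lemma gconst_commute: "F * gconst c = gconst c * F"
  by (rule grassmann_eqI) (simp add: coeff_gconst_times coeff_times_gconst)

lemma coeff_sum: "coeff (\<Sum>i\<in>I. F i) S = (\<Sum>i\<in>I. coeff (F i) S)"
  by (induction I rule: infinite_finite_induct) auto

definition godd :: "'g::{finite,linorder} grassmann \<Rightarrow> bool" where
  "godd F \<longleftrightarrow> (\<forall>S. even (card S) \<longrightarrow> coeff F S = 0)"

lemma godd_anticommute:
  assumes "godd v" "godd w"
  shows "v * w = - (w * v)"
proof (rule grassmann_eqI)
  fix U
  have "coeff (v * w) U = (\<Sum>S\<in>Pow U. (- 1) ^ inversions (U - S) S * coeff v (U - S) * coeff w S)"
    unfolding coeff_times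
    by (rule sum.reindex_bij_witness[where i = "\<lambda>S. U - S" and j = "\<lambda>S. U - S"])
      (auto simp: double_diff)
  also have "\<dots> = (\<Sum>S\<in>Pow U. - ((- 1) ^ inversions S (U - S) * coeff w S * coeff v (U - S)))"
  proof (rule sum.cong, simp)
    fix S assume "S \<in> Pow U"
    show "(- 1) ^ inversions (U - S) S * coeff v (U - S) * coeff w S =
      - ((- 1) ^ inversions S (U - S) * coeff w S * coeff v (U - S))"
    proof (cases "odd (card S) \<and> odd (card (U - S))")
      case True
      then have "odd (inversions S (U - S) + inversions (U - S) S)"
        by (simp add: inversions_commute)
      then have "(- 1 :: complex) ^ inversions (U - S) S = - ((- 1) ^ inversions S (U - S))"
        by (auto simp: minus_one_power_iff)
      then show ?thesis by simp
    next
      case False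
      then show ?thesis using assms by (auto simp: godd_def)
    qed
  qed
  also have "\<dots> = coeff (- (w * v)) U"
    by (simp add: coeff_times sum_negf)
  finally show "coeff (v * w) U = coeff (- (w * v)) U" .
qed

lemma godd_square:
  assumes "godd v"
  shows "v * v = 0"
proof (rule grassmann_eqI)
  fix S
  have "coeff (v * v) S = - coeff (v * v) S"
    using godd_anticommute[OF assms assms] by (metis coeff_simps(5))
  then have "2 * coeff (v * v) S = 0"
    by (simp only: eq_neg_iff_add_eq_0 mult_2)
  then show "coeff (v * v) S = coeff 0 S" by simp
qed

lemma godd_simps:
  "godd 0" "godd (gen g)" "godd v \<Longrightarrow> godd w \<Longrightarrow> godd (v + w)"
  "godd v \<Longrightarrow> godd w \<Longrightarrow> godd (v - w)" "godd v \<Longrightarrow> godd (- v)"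
  "godd v \<Longrightarrow> godd (gconst c * v)" "godd v \<Longrightarrow> godd (v * gconst c)"
  by (auto simp: godd_def coeff_gconst_times coeff_times_gconst)

lemma godd_sum: "(\<And>i. i \<in> I \<Longrightarrow> godd (v i)) \<Longrightarrow> godd (\<Sum>i\<in>I. v i)"
  by (simp add: godd_def coeff_sum)


section \<open>Berezin integration\<close>

text \<open>
  \<open>berezin1 g\<close> integrates over the single generator \<open>g\<close>: writing \<open>F = g * G + H\<close> with \<open>G\<close>, \<open>H\<close>
  free of \<open>g\<close>, its value is \<open>G\<close>.  Consequently \<open>berezin [g\<^sub>1, \<dots>, g\<^sub>n] F\<close> is the coefficient \<open>G\<close>
  of \<open>g\<^sub>1 \<cdots> g\<^sub>n\<close> in \<open>F = g\<^sub>1 \<cdots> g\<^sub>n * G + \<dots>\<close>.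
\<close>

definition berezin1 :: "'g::{finite,linorder} \<Rightarrow> 'g grassmann \<Rightarrow> 'g grassmann" where
  "berezin1 g F =
     Grassmann (\<lambda>S. if g \<in> S then 0 else (- 1) ^ card {s \<in> S. s < g} * coeff F (insert g S))"

definition berezin :: "'g::{finite,linorder} list \<Rightarrow> 'g grassmann \<Rightarrow> 'g grassmann" where
  "berezin gs F = fold berezin1 gs F"

lemma coeff_berezin1:
  "coeff (berezin1 g F) S =
     (if g \<in> S then 0 else (- 1) ^ card {s \<in> S. s < g} * coeff F (insert g S))"
  by (simp add: berezin1_def)

lemma berezin1_linear:
  "berezin1 g 0 = 0" "berezin1 g (F + G) = berezin1 g F + berezin1 g G"
  "berezin1 g (F - G) = berezin1 g F - berezin1 g G" "berezin1 g (- F) = - berezin1 g F"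
  "berezin1 g (gconst c * F) = gconst c * berezin1 g F"
  "berezin1 g (gconst c) = 0"
  by (rule grassmann_eqI, simp add: coeff_berezin1 coeff_gconst_times algebra_simps)+

lemma berezin1_gen: "berezin1 g (gen h) = (if g = h then 1 else 0)"
  by (rule grassmann_eqI) (auto simp: coeff_berezin1)

lemma card_split_at:
  fixes g :: "'g::{finite,linorder}"
  assumes "g \<notin> S"
  shows "card S = card {s \<in> S. s < g} + card {s \<in> S. g < s}"
proof -
  have "S = {s \<in> S. s < g} \<union> {s \<in> S. g < s}"
    using assms linorder_less_linear by blast
  moreover have "card ({s \<in> S. s < g} \<union> {s \<in> S. g < s}) = card {s \<in> S. s < g} + card {s \<in> S. g < s}"
    by (rule card_Un_disjoint) auto
  ultimately show ?thesis by metis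
qed

lemma berezin1_godd_times:
  assumes "godd v"
  shows "berezin1 g (v * F) = berezin1 g v * F - v * berezin1 g F"
proof (rule grassmann_eqI)
  fix U
  show "coeff (berezin1 g (v * F)) U = coeff (berezin1 g v * F - v * berezin1 g F) U"
  proof (cases "g \<in> U")
    case True
    have "coeff (berezin1 g v * F) U = (\<Sum>S\<in>Pow U. if g \<in> S then 0 else
            (- 1) ^ (inversions S (U - S) + card {s \<in> S. s < g}) * coeff v (insert g S) * coeff F (U - S))"
      unfolding coeff_times by (rule sum.cong) (auto simp: coeff_berezin1 power_add)
    also have "\<dots> = (\<Sum>S\<in>{S \<in> Pow U. g \<notin> S}.
            (- 1) ^ (inversions S (U - S) + card {s \<in> S. s < g}) * coeff v (insert g S) * coeff F (U - S))"
      by (rule sum.mono_neutral_cong_right) auto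
    also have "\<dots> = (\<Sum>S\<in>{S \<in> Pow U. g \<in> S}.
            (- 1) ^ inversions S (U - S) * coeff v S *
            ((- 1) ^ card {s \<in> U - S. s < g} * coeff F (insert g (U - S))))"
    proof (rule sum.reindex_bij_witness[where i = "\<lambda>S. S - {g}" and j = "insert g"])
      fix S assume S: "S \<in> {S \<in> Pow U. g \<notin> S}"
      let ?T = "U - insert g S"
      have T: "U - S = insert g ?T" using S True by auto
      have i1: "inversions S (U - S) = card {s \<in> S. g < s} + inversions S ?T"
        using inversions_Un_right[of "{g}" ?T S] by (simp add: T inversions_singleton_right)
      have i2: "inversions (insert g S) ?T = card {t \<in> ?T. t < g} + inversions S ?T"
        using inversions_Un_left[of "{g}" S ?T] S by (simp add: inversions_singleton_left)
      have c: "card S = card {s \<in> S. s < g} + card {s \<in> S. g < s}"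
        using S by (intro card_split_at) auto
      show "(- 1) ^ inversions (insert g S) ?T * coeff v (insert g S) *
            ((- 1) ^ card {s \<in> ?T. s < g} * coeff F (insert g ?T)) =
            (- 1) ^ (inversions S (U - S) + card {s \<in> S. s < g}) * coeff v (insert g S) * coeff F (U - S)"
      proof (cases "odd (card (insert g S))")
        case True
        then have "even (card {s \<in> S. s < g} + card {s \<in> S. g < s})"
          using S c by (simp add: card_insert_if)
        then have "(- 1 :: complex) ^ (card {s \<in> S. s < g} + card {s \<in> S. g < s}) = 1"
          by simp
        moreover have "(- 1 :: complex) ^ card {t \<in> ?T. t < g} * (- 1) ^ card {t \<in> ?T. t < g} = 1"
          by (simp flip: power_add)
        ultimately show ?thesis
          unfolding i1 i2 T[symmetric] by (simp add: power_add mult_ac)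
      next
        case False
        then show ?thesis using assms by (simp add: godd_def)
      qed
    qed (use True in auto)
    also have "\<dots> = coeff (v * berezin1 g F) U"
      unfolding coeff_times
      by (rule sum.mono_neutral_cong_left) (auto simp: coeff_berezin1 True)
    finally show ?thesis using True by (simp add: coeff_berezin1)
  next
    case False
    have "coeff (berezin1 g (v * F)) U = (- 1) ^ card {s \<in> U. s < g} *
        (\<Sum>S\<in>Pow U \<union> insert g ` Pow U.
           (- 1) ^ inversions S (insert g U - S) * coeff v S * coeff F (insert g U - S))"
      using False by (simp add: coeff_berezin1 coeff_times Pow_insert)
    also have "\<dots> =
        (\<Sum>S\<in>Pow U. (- 1) ^ card {s \<in> U. s < g} *
           ((- 1) ^ inversions S (insert g U - S) * coeff v S * coeff F (insert g U - S))) +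
        (\<Sum>S\<in>Pow U. (- 1) ^ card {s \<in> U. s < g} *
           ((- 1) ^ inversions (insert g S) (U - S) * coeff v (insert g S) * coeff F (U - S)))"
    proof -
      have "inj_on (insert g) (Pow U)" using False by (auto simp: inj_on_def)
      moreover have "insert g U - insert g S = U - S" if "S \<in> Pow U" for S
        using False by auto
      ultimately show ?thesis using False
        by (subst sum.union_disjoint)
          (auto simp: distrib_left sum_distrib_left sum.reindex intro!: sum.cong)
    qed
    also have "(\<Sum>S\<in>Pow U. (- 1) ^ card {s \<in> U. s < g} *
           ((- 1) ^ inversions S (insert g U - S) * coeff v S * coeff F (insert g U - S))) =
         - coeff (v * berezin1 g F) U"
      unfolding coeff_times sum_negf[symmetric]
    proof (rule sum.cong, simp)
      fix S assume S: "S \<in> Pow U"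
      let ?T = "U - S"
      have T: "insert g U - S = insert g ?T" using S False by auto
      have i: "inversions S (insert g ?T) = card {s \<in> S. g < s} + inversions S ?T"
        using inversions_Un_right[of "{g}" ?T S] False by (simp add: inversions_singleton_right)
      have c: "card S = card {s \<in> S. s < g} + card {s \<in> S. g < s}"
        using S False by (intro card_split_at) auto
      have u: "card {s \<in> U. s < g} = card {s \<in> S. s < g} + card {s \<in> ?T. s < g}"
        using S by (subst card_Un_disjoint[symmetric]) (auto intro!: arg_cong[where f = card])
      show "(- 1) ^ card {s \<in> U. s < g} *
           ((- 1) ^ inversions S (insert g U - S) * coeff v S * coeff F (insert g U - S)) =
         - ((- 1) ^ inversions S ?T * coeff v S * coeff (berezin1 g F) ?T)"
      proof (cases "odd (card S)")
        case True
        then have m: "(- 1 :: complex) ^ (card {s \<in> S. s < g} + card {s \<in> S. g < s}) = - 1"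
          using c by simp
        have "(- 1) ^ card {s \<in> U. s < g} *
            ((- 1) ^ inversions S (insert g U - S) * coeff v S * coeff F (insert g U - S)) =
          (- 1) ^ (card {s \<in> S. s < g} + card {s \<in> S. g < s}) *
            ((- 1) ^ inversions S ?T * coeff v S * ((- 1) ^ card {s \<in> ?T. s < g} * coeff F (insert g ?T)))"
          unfolding T i u power_add by (simp only: mult_ac)
        also have "\<dots> = - ((- 1) ^ inversions S ?T * coeff v S * coeff (berezin1 g F) ?T)"
          unfolding m using False by (simp add: coeff_berezin1)
        finally show ?thesis .
      next
        case False
        then show ?thesis using assms by (simp add: godd_def)
      qed
    qed
    also have "(\<Sum>S\<in>Pow U. (- 1) ^ card {s \<in> U. s < g} *
           ((- 1) ^ inversions (insert g S) (U - S) * coeff v (insert g S) * coeff F (U - S))) =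
         coeff (berezin1 g v * F) U"
      unfolding coeff_times
    proof (rule sum.cong, simp)
      fix S assume S: "S \<in> Pow U"
      let ?T = "U - S"
      have i: "inversions (insert g S) ?T = card {t \<in> ?T. t < g} + inversions S ?T"
        using inversions_Un_left[of "{g}" S ?T] S False by (auto simp: inversions_singleton_left)
      have u: "card {s \<in> U. s < g} = card {s \<in> S. s < g} + card {s \<in> ?T. s < g}"
        using S by (subst card_Un_disjoint[symmetric]) (auto intro!: arg_cong[where f = card])
      have "(- 1 :: complex) ^ card {t \<in> ?T. t < g} * (- 1) ^ card {t \<in> ?T. t < g} = 1"
        by (simp flip: power_add)
      moreover have "g \<notin> S" using S False by auto
      ultimately show "(- 1) ^ card {s \<in> U. s < g} *
           ((- 1) ^ inversions (insert g S) ?T * coeff v (insert g S) * coeff F ?T) =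
         (- 1) ^ inversions S ?T * coeff (berezin1 g v) S * coeff F ?T"
        unfolding i u by (simp add: coeff_berezin1 power_add mult_ac)
    qed
    finally show ?thesis by simp
  qed
qed

lemma berezin_monomial:
  assumes "distinct gs" and "\<And>g. g \<in> set gs \<Longrightarrow> berezin1 g G = 0"
  shows "berezin gs (prod_list (map gen gs) * G) = G"
  using assms
proof (induction gs)
  case (Cons g gs)
  have "berezin1 g (prod_list (map gen hs) * G) = 0" if "set hs \<subseteq> set gs" for hs
    using that
  proof (induction hs)
    case (Cons h hs)
    with \<open>distinct (g # gs)\<close> show ?case
      by (auto simp: mult.assoc berezin1_godd_times godd_simps berezin1_gen)
  qed (simp add: Cons.prems)
  then have "berezin1 g (gen g * (prod_list (map gen gs) * G)) = prod_list (map gen gs) * G"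
    by (simp add: berezin1_godd_times godd_simps berezin1_gen)
  with Cons show ?case by (simp add: berezin_def mult.assoc)
qed (simp add: berezin_def)

definition delta4 :: "(4 \<Rightarrow> 'g::{finite,linorder} grassmann) \<Rightarrow> 'g grassmann" where
  "delta4 \<eta> = \<eta> 1 * \<eta> 2 * \<eta> 3 * \<eta> 4"

definition berezin4 :: "(4 \<Rightarrow> 'g::{finite,linorder}) \<Rightarrow> 'g grassmann \<Rightarrow> 'g grassmann" where
  "berezin4 p F = berezin [p 1, p 2, p 3, p 4] F"

text \<open>
  Substitution of elements \<open>\<phi> g\<close> for the generators \<open>g\<close>; it gives meaning to \<open>f(\<Psi>\<^sub>0)\<close> in the
  defining property \<open>\<integral>d\<^sup>4\<Psi> \<delta>\<^sup>4(\<Psi> - \<Psi>\<^sub>0) f(\<Psi>) = f(\<Psi>\<^sub>0)\<close> of the fermionic delta function, which is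
  established for \<open>delta4\<close> in \<open>delta4_sifting\<close> below.
\<close>

definition gsubst ::
    "('g \<Rightarrow> 'g::{finite,linorder} grassmann) \<Rightarrow> 'g grassmann \<Rightarrow> 'g grassmann" where
  "gsubst \<phi> F = (\<Sum>S\<in>UNIV. gconst (coeff F S) * prod_list (map \<phi> (sorted_list_of_set S)))"

lemma gen_times_monomial:
  assumes "\<And>t. t \<in> T \<Longrightarrow> g < t"
  shows "gen g * Grassmann (\<lambda>S. if S = T then 1 else 0) =
         Grassmann (\<lambda>S. if S = insert g T then 1 else 0)"
proof (rule grassmann_eqI)
  fix U
  have g: "g \<notin> T" using assms by auto
  have "{t \<in> T. t < g} = {}" using assms by force
  then have i: "inversions {g} T = 0" by (simp only: inversions_singleton_left card.empty)
  have "coeff (gen g * Grassmann (\<lambda>S. if S = T then 1 else 0)) U =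
      (\<Sum>S\<in>Pow U. if S = {g} then (if U - {g} = T then (- 1) ^ inversions {g} (U - {g}) else 0) else 0)"
    unfolding coeff_times by (intro sum.cong) auto
  also have "\<dots> = (if g \<in> U \<and> U - {g} = T then (- 1) ^ inversions {g} (U - {g}) else 0)"
    by (subst sum.delta) auto
  also have "\<dots> = coeff (Grassmann (\<lambda>S. if S = insert g T then 1 else 0)) U"
    using g i by auto
  finally show "coeff (gen g * Grassmann (\<lambda>S. if S = T then 1 else 0)) U =
      coeff (Grassmann (\<lambda>S. if S = insert g T then 1 else 0)) U" .
qed

lemma prod_list_gen_sorted:
  assumes "sorted_wrt (<) gs"
  shows "prod_list (map gen gs) = Grassmann (\<lambda>S. if S = set gs then 1 else 0)"
  using assms
proof (induction gs)
  case Nil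
  then show ?case by (simp add: one_grassmann_def)
next
  case (Cons g gs)
  then have "sorted_wrt (<) gs" "\<And>t. t \<in> set gs \<Longrightarrow> g < t"
    by simp_all
  then show ?case using Cons.IH by (simp add: gen_times_monomial)
qed

lemma gsubst_gen: "gsubst gen F = F"
proof (rule grassmann_eqI)
  fix U
  show "coeff (gsubst gen F) U = coeff F U"
    by (simp add: gsubst_def coeff_sum prod_list_gen_sorted coeff_gconst_times if_distrib
        cong: if_cong)
qed

lemma delta4_commute:
  assumes "\<And>A. godd (\<eta> A)" and "godd v"
  shows "delta4 \<eta> * v = v * delta4 \<eta>"
proof -
  have s: "x * (\<eta> A * v) = - (x * v * \<eta> A)" for A x
    using godd_anticommute[OF assms(1)[of A] assms(2)] by (simp add: mult.assoc)
  have "delta4 \<eta> * v = - (\<eta> 1 * \<eta> 2 * \<eta> 3 * v * \<eta> 4)"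
    unfolding delta4_def by (subst mult.assoc) (rule s)
  also have "\<dots> = \<eta> 1 * \<eta> 2 * v * \<eta> 3 * \<eta> 4"
    by (subst mult.assoc[of "\<eta> 1 * \<eta> 2" "\<eta> 3" v]) (simp add: s)
  also have "\<dots> = - (\<eta> 1 * v * \<eta> 2 * \<eta> 3 * \<eta> 4)"
    by (subst mult.assoc[of "\<eta> 1" "\<eta> 2" v]) (simp add: s)
  also have "\<dots> = v * delta4 \<eta>"
    using godd_anticommute[OF assms(1)[of 1] assms(2)] by (simp add: delta4_def mult.assoc)
  finally show ?thesis .
qed

lemma delta4_times:
  assumes "\<And>A. godd (\<eta> A)"
  shows "delta4 \<eta> * \<eta> A = 0"
proof -
  have s: "x * \<eta> B * \<eta> B = 0" for x B
    using godd_square[OF assms] by (simp add: mult.assoc)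
  have m: "x * \<eta> B * \<eta> C = - (x * \<eta> C * \<eta> B)" for x B C
    using godd_anticommute[OF assms assms, of B C] by (simp add: mult.assoc)
  show ?thesis
    using exhaust_4[of A]
  proof (elim disjE)
    assume "A = 1"
    then show ?thesis
      using delta4_commute[of \<eta> "\<eta> 1"] godd_square[OF assms, of 1] assms
      by (simp add: delta4_def flip: mult.assoc)
  next
    assume "A = 2"
    then show ?thesis
      by (simp add: delta4_def m[of _ 4 2] m[of _ 3 2] s)
  next
    assume "A = 3"
    then show ?thesis
      by (simp add: delta4_def m[of _ 4 3] s)
  next
    assume "A = 4"
    then show ?thesis
      by (simp add: delta4_def s)
  qed
qed

lemma berezin1_free_times:
  assumes "godd w" "berezin1 g w = 0" "berezin1 g F = 0"
  shows "berezin1 g (w * F) = 0"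
  using assms by (simp add: berezin1_godd_times)

theorem delta4_sifting:
  fixes p :: "4 \<Rightarrow> 'g::{finite,linorder}" and v :: "4 \<Rightarrow> 'g grassmann"
  assumes "inj p"
    and odd: "\<And>A. godd (v A)"
    and free: "\<And>A B. berezin1 (p B) (v A) = 0"
    and \<phi>_p: "\<And>A. \<phi> (p A) = v A" and \<phi>_other: "\<And>h. h \<notin> range p \<Longrightarrow> \<phi> h = gen h"
  shows "berezin4 p (delta4 (\<lambda>A. gen (p A) - v A) * F) = gsubst \<phi> F"
proof -
  define D where "D = delta4 (\<lambda>A. gen (p A) - v A)"
  have odd_eta: "godd (gen (p A) - v A)" for A
    by (simp add: godd_simps odd)
  have odd_phi: "godd (\<phi> h)" for h
    by (cases "h \<in> range p") (auto simp: \<phi>_p \<phi>_other odd godd_simps)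
  have free_phi: "berezin1 (p B) (\<phi> h) = 0" for B h
    by (cases "h \<in> range p") (auto simp: \<phi>_p \<phi>_other free berezin1_gen)
  have step: "D * gen h = D * \<phi> h" for h
  proof (cases "h \<in> range p")
    case True
    then obtain A where h: "h = p A" by auto
    have "D * (gen (p A) - v A) = 0"
      using delta4_times[of "\<lambda>A. gen (p A) - v A" A] odd_eta by (simp add: D_def)
    then show ?thesis by (simp add: h \<phi>_p right_diff_distrib)
  qed (simp add: \<phi>_other)
  have mono: "D * prod_list (map gen gs) = D * prod_list (map \<phi> gs)" for gs
  proof (induction gs)
    case (Cons h gs)
    have comm: "D * \<phi> h = \<phi> h * D"
      unfolding D_def by (intro delta4_commute odd_eta odd_phi)
    have "D * prod_list (map gen (h # gs)) = \<phi> h * (D * prod_list (map gen gs))"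
      by (simp add: step comm flip: mult.assoc)
    also have "\<dots> = D * prod_list (map \<phi> (h # gs))"
      by (simp add: Cons comm flip: mult.assoc)
    finally show ?case .
  qed simp
  have push: "D * gsubst \<psi> F =
      (\<Sum>S\<in>UNIV. gconst (coeff F S) * (D * prod_list (map \<psi> (sorted_list_of_set S))))" for \<psi>
    unfolding gsubst_def sum_distrib_left
    by (intro sum.cong refl) (metis gconst_commute mult.assoc)
  have "D * F = D * gsubst gen F" by (simp only: gsubst_gen)
  also have "\<dots> = D * gsubst \<phi> F" by (simp only: push mono)
  finally have DF: "D * F = D * gsubst \<phi> F" .
  have free_list: "berezin1 (p B) (prod_list (map \<phi> gs)) = 0" for B gs
  proof (induction gs)
    case Nil
    show ?case using berezin1_linear(6)[of "p B" 1] by (simp add: gconst_simps)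
  next
    case (Cons h gs)
    then show ?case by (simp add: berezin1_free_times odd_phi free_phi)
  qed
  define G where "G = gsubst \<phi> F"
  have sum_free: "berezin1 g (\<Sum>S\<in>X. H S) = 0" if "\<And>S. berezin1 g (H S) = 0"
    for g :: 'g and X :: "'g set set" and H
    by (induction X rule: infinite_finite_induct) (simp_all add: berezin1_linear that)
  have free_G: "berezin1 (p B) G = 0" for B
    unfolding G_def gsubst_def
    by (rule sum_free) (simp add: berezin1_linear free_list)
  let ?e = "\<lambda>A. gen (p A) - v A"
  have be: "berezin1 (p B) (?e A) = (if A = B then 1 else 0)" for A B
    using assms(1) by (auto simp: berezin1_linear berezin1_gen free inj_eq)
  have zero: "berezin1 (p B) (?e A * H) = 0" if "A \<noteq> B" "berezin1 (p B) H = 0" for A B H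
    using that by (intro berezin1_free_times odd_eta) (auto simp: be)
  have peel: "berezin1 (p A) (?e A * H) = H" if "berezin1 (p A) H = 0" for A H
    using that by (simp add: berezin1_godd_times[OF odd_eta] be)
  have ne: "(1 :: 4) \<noteq> 2" "(1 :: 4) \<noteq> 3" "(1 :: 4) \<noteq> 4" "(2 :: 4) \<noteq> 3" "(2 :: 4) \<noteq> 4" "(3 :: 4) \<noteq> 4"
    by auto
  have "D * G = ?e 1 * (?e 2 * (?e 3 * (?e 4 * G)))"
    by (simp add: D_def delta4_def mult.assoc)
  then have "berezin4 p (D * G) = G"
    unfolding berezin4_def berezin_def using ne
    by (simp only: fold.simps comp_apply id_apply) (simp add: peel zero free_G)
  then show ?thesis using DF by (simp add: D_def G_def)
qed


section \<open>The setting of the amplitude\<close>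

text \<open>
  Type \<open>4\<close> serves as the index set \<open>{1, 2, 3, 4}\<close>, both for \<open>SU(4)\<close> indices and for particle
  labels.  Its arithmetic is modulo 4, so \<open>i + 1\<close> is the cyclic successor and \<open>4 + 1 = 1\<close>.
\<close>

lemma vector_4 [simp]:
  "(vector [w, x, y, z] :: 'a::zero ^ 4) $ 1 = w"
  "(vector [w, x, y, z] :: 'a::zero ^ 4) $ 2 = x"
  "(vector [w, x, y, z] :: 'a::zero ^ 4) $ 3 = y"
  "(vector [w, x, y, z] :: 'a::zero ^ 4) $ 4 = z"
  unfolding vector_def by simp_all

definition levi_civita :: "4 \<Rightarrow> 4 \<Rightarrow> 4 \<Rightarrow> 4 \<Rightarrow> complex" where
  "levi_civita A B C D =
     (let p = (\<lambda>i. (vector [A, B, C, D] :: 4 ^ 4) $ i) in if bij p then of_int (sign p) else 0)"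

datatype generator = Theta1 4 | Theta2 4 | Psi 4 4

instance generator :: finite
proof
  have "(UNIV :: generator set) = range Theta1 \<union> range Theta2 \<union> range (case_prod Psi)"
    using generator.exhaust by (auto simp: image_iff) metis
  then show "finite (UNIV :: generator set)"
    by (rule ssubst) (intro finite_UnI finite_imageI finite)
qed

instantiation generator :: linorder
begin

fun less_eq_generator :: "generator \<Rightarrow> generator \<Rightarrow> bool" where
  "Theta1 A \<le> Theta1 B \<longleftrightarrow> A \<le> B"
| "Theta2 A \<le> Theta2 B \<longleftrightarrow> A \<le> B"
| "Psi i A \<le> Psi j B \<longleftrightarrow> i < j \<or> i = j \<and> A \<le> B"
| "Theta1 A \<le> _ \<longleftrightarrow> True"
| "Theta2 A \<le> Psi j B \<longleftrightarrow> True"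
| "_ \<le> (_ :: generator) \<longleftrightarrow> False"

definition "x < y \<longleftrightarrow> x \<le> y \<and> \<not> y \<le> (x :: generator)"

instance
proof
  fix x y z :: generator
  show "x < y \<longleftrightarrow> x \<le> y \<and> \<not> y \<le> x" by (rule less_generator_def)
  show "x \<le> x" by (cases x) auto
  show "x \<le> y \<Longrightarrow> y \<le> z \<Longrightarrow> x \<le> z" by (cases x; cases y; cases z) auto
  show "x \<le> y \<Longrightarrow> y \<le> x \<Longrightarrow> x = y" by (cases x; cases y) auto
  show "x \<le> y \<or> y \<le> x" by (cases x; cases y) auto
qed

end

abbreviation theta1 :: "4 \<Rightarrow> generator grassmann" where "theta1 A \<equiv> gen (Theta1 A)"
abbreviation theta2 :: "4 \<Rightarrow> generator grassmann" where "theta2 A \<equiv> gen (Theta2 A)"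
abbreviation psi :: "4 \<Rightarrow> 4 \<Rightarrow> generator grassmann" where "psi i A \<equiv> gen (Psi i A)"

definition int_d8theta :: "generator grassmann \<Rightarrow> generator grassmann" where
  "int_d8theta = berezin [Theta1 1, Theta1 2, Theta1 3, Theta1 4,
                          Theta2 1, Theta2 2, Theta2 3, Theta2 4]"

definition int_d4psi :: "4 \<Rightarrow> generator grassmann \<Rightarrow> generator grassmann" where
  "int_d4psi i = berezin4 (Psi i)"

definition angle :: "complex ^ 4 \<Rightarrow> 4 \<Rightarrow> 4 \<Rightarrow> complex" where
  "angle Z i j = Z $ j - Z $ i"

definition curve_delta :: "complex ^ 4 ^ 4 \<Rightarrow> complex ^ 4 \<Rightarrow> 4 \<Rightarrow> generator grassmann" where
  "curve_delta M Z i = delta4 (\<lambda>A.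
     psi i A + theta1 A + theta2 A * gconst (Z $ i)
     - gconst (1 / 6) * (\<Sum>B\<in>UNIV. \<Sum>C\<in>UNIV. \<Sum>D\<in>UNIV. \<Sum>E\<in>UNIV.
         gconst (M $ A $ B * levi_civita B C D E) * theta2 C * theta2 D * theta2 E)
       * gconst ((Z $ i)\<^sup>2))"

definition wavefunction_plus_half :: "4 \<Rightarrow> complex ^ 4 \<Rightarrow> generator grassmann" where
  "wavefunction_plus_half i chi = (\<Sum>A\<in>UNIV. psi i A * gconst (chi $ A))"

definition wavefunction_minus_half :: "4 \<Rightarrow> complex ^ 4 \<Rightarrow> generator grassmann" where
  "wavefunction_minus_half i chi =
     gconst (1 / 6) * (\<Sum>A\<in>UNIV. \<Sum>B\<in>UNIV. \<Sum>C\<in>UNIV. \<Sum>D\<in>UNIV.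
       gconst (levi_civita A B C D) * psi i A * psi i B * psi i C * gconst (chi $ D))"

lemma levi_civita_1234: "levi_civita 1 2 3 4 = 1"
proof -
  have "(\<lambda>i. (vector [1, 2, 3, 4] :: 4 ^ 4) $ i) = id"
  proof
    fix i :: 4
    show "(vector [1, 2, 3, 4] :: 4 ^ 4) $ i = id i"
      using exhaust_4[of i] by auto
  qed
  then show ?thesis by (simp only: levi_civita_def Let_def bij_id sign_id) simp
qed

lemma levi_civita_swap:
  assumes "j \<noteq> k"
    and "\<And>i. (vector [A', B', C', D'] :: 4 ^ 4) $ i = (vector [A, B, C, D] :: 4 ^ 4) $ (Transposition.transpose j k i)"
  shows "levi_civita A' B' C' D' = - levi_civita A B C D"
proof -
  define p where "p = (\<lambda>i. (vector [A, B, C, D] :: 4 ^ 4) $ i)"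
  have p': "(\<lambda>i. (vector [A', B', C', D'] :: 4 ^ 4) $ i) = p \<circ> Transposition.transpose j k"
    using assms(2) by (auto simp: p_def)
  have b: "bij (p \<circ> Transposition.transpose j k) \<longleftrightarrow> bij p"
  proof
    assume "bij (p \<circ> Transposition.transpose j k)"
    then have "bij (p \<circ> Transposition.transpose j k \<circ> Transposition.transpose j k)"
      by (rule bij_comp[OF bij_transpose])
    then show "bij p" by (simp add: comp_assoc)
  qed (rule bij_comp, simp_all)
  have "sign (p \<circ> Transposition.transpose j k) = sign p * sign (Transposition.transpose j k)" if "bij p"
    by (rule sign_compose) (use that in \<open>simp_all add: permutation permutation_swap_id\<close>)
  then have "sign (p \<circ> Transposition.transpose j k) = - sign p" if "bij p"
    using that assms(1) by (simp add: sign_swap_id)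
  then show ?thesis
    unfolding levi_civita_def p' p_def[symmetric] Let_def using b by simp
qed

lemma levi_civita_antisymmetric:
  "levi_civita B A C D = - levi_civita A B C D"
  "levi_civita A C B D = - levi_civita A B C D"
  "levi_civita A B D C = - levi_civita A B C D"
proof -
  have 12: "(vector [B, A, C, D] :: 4 ^ 4) $ i = (vector [A, B, C, D] :: 4 ^ 4) $ Transposition.transpose 1 2 i"
    and 23: "(vector [A, C, B, D] :: 4 ^ 4) $ i = (vector [A, B, C, D] :: 4 ^ 4) $ Transposition.transpose 2 3 i"
    and 34: "(vector [A, B, D, C] :: 4 ^ 4) $ i = (vector [A, B, C, D] :: 4 ^ 4) $ Transposition.transpose 3 4 i"
    for i :: 4
    using exhaust_4[of i] by (elim disjE; simp add: Transposition.transpose_def)+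
  show "levi_civita B A C D = - levi_civita A B C D"
    by (rule levi_civita_swap[OF _ 12]) simp
  show "levi_civita A C B D = - levi_civita A B C D"
    by (rule levi_civita_swap[OF _ 23]) simp
  show "levi_civita A B D C = - levi_civita A B C D"
    by (rule levi_civita_swap[OF _ 34]) simp
qed

end

theory Submission
  imports Defs
begin

text \<open>
  Using the third delta function to integrate over \<open>\<theta>\<^sub>1\<close> instead of \<open>\<Psi>\<^sub>3\<close> replaces \<open>\<theta>\<^sub>1\<close> by \<open>\<Psi>\<^sub>3\<close> as the
  base point of the curve; the others then fix
  \<open>\<Psi>\<^sub>i = \<Psi>\<^sub>3 - \<theta>\<^sub>2 (Z\<^sub>i - Z\<^sub>3) + M T (Z\<^sub>i\<^sup>2 - Z\<^sub>3\<^sup>2)\<close>, where \<open>T\<^sub>B = \<epsilon>\<^bsub>BCDE\<^esub> \<theta>\<^sub>2\<^sup>C \<theta>\<^sub>2\<^sup>D \<theta>\<^sub>2\<^sup>E / 6\<close>.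
  No deformation is left in the cubic wavefunction \<open>f\<^sub>3\<close>.  The integral over \<open>\<Psi>\<^sub>3\<close> therefore takes \<open>\<Psi>\<^sub>3\<close>
  from exactly one of \<open>f\<^sub>1, f\<^sub>2, f\<^sub>4\<close>, and the integral over \<open>\<theta>\<^sub>2\<close> takes \<open>\<theta>\<^sub>2\<close> from one and \<open>T\<close> from the other
  of the remaining two.  By \<open>\<theta>\<^sub>2\<^sup>A T\<^sub>B = \<delta>\<^sup>A\<^sub>B \<theta>\<^sub>2\<^sup>1 \<theta>\<^sub>2\<^sup>2 \<theta>\<^sub>2\<^sup>3 \<theta>\<^sub>2\<^sup>4\<close> and the symmetry of \<open>M\<close>, the two choices combine to
  the factor \<open>(Z\<^sub>i - Z\<^sub>3) (Z\<^sub>j - Z\<^sub>3) (Z\<^sub>i - Z\<^sub>j)\<close>.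
\<close>

section \<open>Grassmann algebra and iterated Berezin integrals\<close>

text \<open>A vanishing integral over \<open>g\<close> is how independence of \<open>g\<close> is
  expressed throughout; this characterisation in terms of monomials makes it easy to propagate
  through products.\<close>

lemma berezin1_eq_0_iff: "berezin1 g F = 0 \<longleftrightarrow> (\<forall>S. g \<in> S \<longrightarrow> coeff F S = 0)"
proof
  assume *: "berezin1 g F = 0"
  show "\<forall>S. g \<in> S \<longrightarrow> coeff F S = 0"
  proof (intro allI impI)
    fix S assume "g \<in> S"
    moreover have "coeff (berezin1 g F) (S - {g}) = 0" by (simp add: *)
    ultimately show "coeff F S = 0" by (simp add: coeff_berezin1 insert_absorb)
  qed
next
  assume "\<forall>S. g \<in> S \<longrightarrow> coeff F S = 0"
  then show "berezin1 g F = 0"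
    by (intro grassmann_eqI) (simp add: coeff_berezin1)
qed

lemma berezin1_mult_eq_0:
  assumes "berezin1 g F = 0" "berezin1 g G = 0"
  shows "berezin1 g (F * G) = 0"
  using assms unfolding berezin1_eq_0_iff coeff_times
  by (auto intro!: sum.neutral) (metis Diff_iff)

lemma berezin1_sum: "berezin1 g (\<Sum>i\<in>I. F i) = (\<Sum>i\<in>I. berezin1 g (F i))"
  by (induction I rule: infinite_finite_induct) (simp_all add: berezin1_linear)

text \<open>For \<open>g < h\<close>, inserting \<open>g\<close> raises the number of generators
  below \<open>h\<close> by one, whereas inserting \<open>h\<close> leaves the number below
  \<open>g\<close> unchanged. This is the single relative sign. For \<open>g = h\<close> both sides
  vanish.\<close>

lemma berezin1_commute: "berezin1 g (berezin1 h F) = - berezin1 h (berezin1 g F)"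
proof -
  have *: "berezin1 g (berezin1 h F) = - berezin1 h (berezin1 g F)" if "g < h"
    for g h :: 'a
  proof (rule grassmann_eqI)
    fix S
    have 1: "{s \<in> insert g S. s < h} = insert g {s \<in> S. s < h}"
      and 2: "{s \<in> insert h S. s < g} = {s \<in> S. s < g}"
      using that by auto
    show "coeff (berezin1 g (berezin1 h F)) S = coeff (- berezin1 h (berezin1 g F)) S"
      unfolding coeff_simps coeff_berezin1 1 2
      using that by (auto simp: insert_commute mult_ac)
  qed
  consider "g < h" | "h < g" | "g = h" by (rule linorder_cases)
  then show ?thesis
  proof cases
    case 3
    then show ?thesis by (auto intro: grassmann_eqI simp: coeff_berezin1)
  qed (simp_all add: *)
qed

section \<open>Fourfold integrals\<close>

lemma berezin4_unfold:
  "berezin4 p F = berezin1 (p 4) (berezin1 (p 3) (berezin1 (p 2) (berezin1 (p 1) F)))"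
  by (simp add: berezin4_def berezin_def)

text \<open>Passing four single integrals costs four signs, which cancel. Hence fourfold integrals
  may be taken in any order.\<close>

lemma berezin1_berezin4_commute: "berezin1 g (berezin4 q F) = berezin4 q (berezin1 g F)"
  unfolding berezin4_unfold by (simp add: berezin1_commute[of g] berezin1_linear)

lemma berezin4_commute: "berezin4 p (berezin4 q F) = berezin4 q (berezin4 p F)"
  unfolding berezin4_unfold[of p] by (simp add: berezin1_berezin4_commute)

lemma berezin4_linear:
  "berezin4 p 0 = 0" "berezin4 p (F + G) = berezin4 p F + berezin4 p G"
  "berezin4 p (F - G) = berezin4 p F - berezin4 p G" "berezin4 p (- F) = - berezin4 p F"
  "berezin4 p (gconst c * F) = gconst c * berezin4 p F"
  by (simp_all add: berezin4_unfold berezin1_linear)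

lemma berezin4_free_times:
  assumes "godd v" "\<And>A. berezin1 (p A) v = 0"
  shows "berezin4 p (v * F) = v * berezin4 p F"
  unfolding berezin4_unfold using assms by (simp add: berezin1_godd_times berezin1_linear)

section \<open>Replacing factors next to a central delta function\<close>

lemma commutes_if_commutes_with_gens:
  fixes F :: "'g::{finite,linorder} grassmann"
  assumes "\<And>h. D * gen h = gen h * D"
  shows "D * F = F * D"
proof -
  have "D * prod_list (map gen gs) = prod_list (map gen gs) * D" for gs
    by (induction gs) (simp_all, metis assms mult.assoc)
  then have "D * (gconst c * prod_list (map gen gs)) = gconst c * prod_list (map gen gs) * D" for c gs
    by (metis gconst_commute mult.assoc)
  then have "D * gsubst gen F = gsubst gen F * D"
    by (simp add: gsubst_def sum_distrib_left sum_distrib_right)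
  then show ?thesis by (simp only: gsubst_gen)
qed

lemma delta4_central:
  assumes "\<And>A. godd (\<eta> A)"
  shows "delta4 \<eta> * F = F * delta4 \<eta>"
  by (rule commutes_if_commutes_with_gens) (intro delta4_commute assms godd_simps(2))

text \<open>Since \<open>D\<close> is central, it can be carried to each factor in turn, so an
  equality that holds only next to \<open>D\<close> may be applied inside a product without
  signs.\<close>

lemma central_times_cong:
  fixes D :: "'g::{finite,linorder} grassmann"
  assumes "\<And>F. D * F = F * D" "D * a = D * b" "D * x = D * y"
  shows "D * (a * x) = D * (b * y)"
proof -
  have "D * (a * x) = b * (D * x)"
    using assms(2) by (simp add: assms(1)[of b] flip: mult.assoc)
  also have "\<dots> = D * (b * y)"
    by (simp add: assms(3)) (simp add: assms(1)[of b] flip: mult.assoc)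
  finally show ?thesis .
qed

lemma central_delta4_cong:
  assumes "\<And>F. D * F = F * D" "\<And>A. D * \<eta> A = D * \<zeta> A"
  shows "D * delta4 \<eta> = D * delta4 \<zeta>"
  unfolding delta4_def by (intro central_times_cong assms)

lemma gsubst_cong:
  assumes "\<And>S g. coeff F S \<noteq> 0 \<Longrightarrow> g \<in> S \<Longrightarrow> \<phi> g = \<psi> g"
  shows "gsubst \<phi> F = gsubst \<psi> F"
  unfolding gsubst_def
proof (rule sum.cong)
  fix S
  show "gconst (coeff F S) * prod_list (map \<phi> (sorted_list_of_set S)) =
    gconst (coeff F S) * prod_list (map \<psi> (sorted_list_of_set S))"
  proof (cases "coeff F S = 0")
    case False
    then have "map \<phi> (sorted_list_of_set S) = map \<psi> (sorted_list_of_set S)"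
      using assms by simp
    then show ?thesis by (simp only:)
  qed (simp add: gconst_simps)
qed simp

text \<open>Sifting in the case where the substitution finds nothing to replace: no monomial of
  \<open>G\<close> contains an integration variable.\<close>

lemma berezin4_delta4_times_free:
  fixes p :: "4 \<Rightarrow> 'g::{finite,linorder}" and v :: "4 \<Rightarrow> 'g grassmann"
  assumes "inj p" "\<And>A. godd (v A)" "\<And>A B. berezin1 (p B) (v A) = 0"
    and free: "\<And>B. berezin1 (p B) G = 0"
  shows "berezin4 p (delta4 (\<lambda>A. gen (p A) - v A) * G) = G"
proof -
  define \<phi> where "\<phi> h = (if h \<in> range p then v (inv p h) else gen h)" for h
  have "berezin4 p (delta4 (\<lambda>A. gen (p A) - v A) * G) = gsubst \<phi> G"
    using assms by (intro delta4_sifting) (auto simp: \<phi>_def)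
  also have "\<dots> = gsubst gen G"
    using free by (intro gsubst_cong) (auto simp: \<phi>_def berezin1_eq_0_iff)
  finally show ?thesis by (simp only: gsubst_gen)
qed

section \<open>Cubic cofactors\<close>

lemma levi_civita_repeated:
  "levi_civita A A C D = 0" "levi_civita A B A D = 0" "levi_civita A B C A = 0"
  "levi_civita A B B D = 0" "levi_civita A B C B = 0" "levi_civita A B C C = 0"
proof -
  have 1: "levi_civita A A C D = 0" and 2: "levi_civita A B B D = 0"
    and 3: "levi_civita A B C C = 0" for A B C D
    using levi_civita_antisymmetric(1)[of A A C D] levi_civita_antisymmetric(2)[of A B B D]
      levi_civita_antisymmetric(3)[of A B C C] by simp_all
  show "levi_civita A A C D = 0" "levi_civita A B B D = 0" "levi_civita A B C C = 0"
    by (fact 1 2 3)+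
  show "levi_civita A B A D = 0" "levi_civita A B C B = 0" "levi_civita A B C A = 0"
    using levi_civita_antisymmetric(2)[of A A B D] levi_civita_antisymmetric(3)[of A B B C]
      levi_civita_antisymmetric(2)[of A A B C] levi_civita_antisymmetric(3)[of A B A C]
    by (simp_all add: 1 2)
qed

text \<open>For odd \<open>v\<close> this is the formal left derivative of \<open>delta4 v\<close>
  with respect to \<open>v A\<close>, that is, the signed product of the other three components. For
  \<open>theta2\<close> it is the cubic term of the curve equation.\<close>

definition cofactor :: "(4 \<Rightarrow> 'g::{finite,linorder} grassmann) \<Rightarrow> 4 \<Rightarrow> 'g grassmann" where
  "cofactor v A = gconst (1 / 6) * (\<Sum>B\<in>UNIV. \<Sum>C\<in>UNIV. \<Sum>D\<in>UNIV.
     gconst (levi_civita A B C D) * v B * v C * v D)"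

lemma levi_civita_values:
  "levi_civita 1 2 3 4 = 1" "levi_civita 1 2 4 3 = -1" "levi_civita 1 3 2 4 = -1"
  "levi_civita 1 3 4 2 = 1" "levi_civita 1 4 2 3 = 1" "levi_civita 1 4 3 2 = -1"
  "levi_civita 2 1 3 4 = -1" "levi_civita 2 1 4 3 = 1" "levi_civita 2 3 1 4 = 1"
  "levi_civita 2 3 4 1 = -1" "levi_civita 2 4 1 3 = -1" "levi_civita 2 4 3 1 = 1"
  "levi_civita 3 1 2 4 = 1" "levi_civita 3 1 4 2 = -1" "levi_civita 3 2 1 4 = -1"
  "levi_civita 3 2 4 1 = 1" "levi_civita 3 4 1 2 = 1" "levi_civita 3 4 2 1 = -1"
  "levi_civita 4 1 2 3 = -1" "levi_civita 4 1 3 2 = 1" "levi_civita 4 2 1 3 = 1"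
  "levi_civita 4 2 3 1 = -1" "levi_civita 4 3 1 2 = -1" "levi_civita 4 3 2 1 = 1"
proof -
  note a = levi_civita_antisymmetric
  show 1: "levi_civita 1 2 3 4 = 1" by (rule levi_civita_1234)
  show 2: "levi_civita 1 2 4 3 = -1" using a(3)[of 1 2 4 3] 1 by simp
  show 3: "levi_civita 1 3 2 4 = -1" using a(2)[of 1 3 2 4] 1 by simp
  show 4: "levi_civita 1 3 4 2 = 1" using a(3)[of 1 3 4 2] 3 by simp
  show 5: "levi_civita 1 4 2 3 = 1" using a(2)[of 1 4 2 3] 2 by simp
  show 6: "levi_civita 1 4 3 2 = -1" using a(3)[of 1 4 3 2] 5 by simp
  show 7: "levi_civita 2 1 3 4 = -1" using a(1)[of 2 1 3 4] 1 by simp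
  show 8: "levi_civita 2 1 4 3 = 1" using a(3)[of 2 1 4 3] 7 by simp
  show 9: "levi_civita 2 3 1 4 = 1" using a(2)[of 2 3 1 4] 7 by simp
  show 10: "levi_civita 2 3 4 1 = -1" using a(3)[of 2 3 4 1] 9 by simp
  show 11: "levi_civita 2 4 1 3 = -1" using a(2)[of 2 4 1 3] 8 by simp
  show 12: "levi_civita 2 4 3 1 = 1" using a(3)[of 2 4 3 1] 11 by simp
  show 13: "levi_civita 3 1 2 4 = 1" using a(1)[of 3 1 2 4] 3 by simp
  show 14: "levi_civita 3 1 4 2 = -1" using a(3)[of 3 1 4 2] 13 by simp
  show 15: "levi_civita 3 2 1 4 = -1" using a(2)[of 3 2 1 4] 13 by simp
  show 16: "levi_civita 3 2 4 1 = 1" using a(3)[of 3 2 4 1] 15 by simp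
  show 17: "levi_civita 3 4 1 2 = 1" using a(2)[of 3 4 1 2] 14 by simp
  show 18: "levi_civita 3 4 2 1 = -1" using a(3)[of 3 4 2 1] 17 by simp
  show 19: "levi_civita 4 1 2 3 = -1" using a(1)[of 4 1 2 3] 5 by simp
  show 20: "levi_civita 4 1 3 2 = 1" using a(3)[of 4 1 3 2] 19 by simp
  show 21: "levi_civita 4 2 1 3 = 1" using a(2)[of 4 2 1 3] 19 by simp
  show 22: "levi_civita 4 2 3 1 = -1" using a(3)[of 4 2 3 1] 21 by simp
  show 23: "levi_civita 4 3 1 2 = -1" using a(2)[of 4 3 1 2] 20 by simp
  show 24: "levi_civita 4 3 2 1 = 1" using a(3)[of 4 3 2 1] 23 by simp
qed

text \<open>Only the six orderings of the three other indices contribute. Sorting the odd factors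
  gives the same sign as sorting the indices of \<open>levi_civita\<close>, so the six terms agree
  and cancel the factor 1/6.\<close>

lemma cofactor_eq:
  fixes v :: "4 \<Rightarrow> 'g::{finite,linorder} grassmann"
  assumes odd: "\<And>A. godd (v A)"
  shows "cofactor v 1 = v 2 * (v 3 * v 4)" "cofactor v 2 = - (v 1 * (v 3 * v 4))"
    "cofactor v 3 = v 1 * (v 2 * v 4)" "cofactor v 4 = - (v 1 * (v 2 * v 3))"
proof -
  have swap: "v 2 * v 1 = - (v 1 * v 2)" "v 3 * v 1 = - (v 1 * v 3)" "v 4 * v 1 = - (v 1 * v 4)"
    "v 3 * v 2 = - (v 2 * v 3)" "v 4 * v 2 = - (v 2 * v 4)" "v 4 * v 3 = - (v 3 * v 4)"
    by (rule godd_anticommute[OF odd odd])+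
  have swap': "v 2 * (v 1 * x) = - (v 1 * (v 2 * x))" "v 3 * (v 1 * x) = - (v 1 * (v 3 * x))"
    "v 4 * (v 1 * x) = - (v 1 * (v 4 * x))" "v 3 * (v 2 * x) = - (v 2 * (v 3 * x))"
    "v 4 * (v 2 * x) = - (v 2 * (v 4 * x))" "v 4 * (v 3 * x) = - (v 3 * (v 4 * x))" for x
    by (simp_all add: swap flip: mult.assoc)
  \<comment> \<open>The bracketing is that of the nested sums: three choices of the first index,
    each with two orders of the remaining pair.\<close>
  have sixth: "gconst (1 / 6) * (x + x + (x + x) + (x + x)) = x"  for x :: "'g grassmann"
    by (rule grassmann_eqI) (simp add: coeff_gconst_times)
  have eval: "gconst (1 / 6) * y = x" if "y = x + x + (x + x) + (x + x)" for x y :: "'g grassmann"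
    using that sixth by simp
  show "cofactor v 1 = v 2 * (v 3 * v 4)" "cofactor v 2 = - (v 1 * (v 3 * v 4))"
    "cofactor v 3 = v 1 * (v 2 * v 4)" "cofactor v 4 = - (v 1 * (v 2 * v 3))"
    unfolding cofactor_def
    by (rule eval; simp add: sum_4 levi_civita_values levi_civita_repeated gconst_simps
        mult.assoc swap swap')+
qed

text \<open>This is the Grassmann analogue of expanding a determinant: off the diagonal
  \<open>v A\<close> occurs twice and squares to zero, on the diagonal the sign of the cofactor
  moves \<open>v A\<close> to its place in \<open>delta4 v\<close>.\<close>

lemma times_cofactor:
  fixes v :: "4 \<Rightarrow> 'g::{finite,linorder} grassmann"
  assumes odd: "\<And>A. godd (v A)"
  shows "v A * cofactor v B = (if A = B then delta4 v else 0)"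
proof -
  have sq: "v A * v A = 0" "v A * (v A * x) = 0" for A x
    using godd_square[OF odd[of A]] by (simp_all flip: mult.assoc)
  have swap: "v B * v A = - (v A * v B)" "v B * (v A * x) = - (v A * (v B * x))" for A B x
    using godd_anticommute[OF odd[of B] odd[of A]] by (simp_all flip: mult.assoc)
  show ?thesis
    using exhaust_4[of A] exhaust_4[of B]
    by (elim disjE) (simp_all add: cofactor_eq odd delta4_def mult.assoc sq
        swap[of 2 1] swap[of 3 1] swap[of 4 1] swap[of 3 2] swap[of 4 2] swap[of 4 3])
qed

section \<open>Parity and degree\<close>

lemma godd_mult3:
  assumes "godd F" "godd G" "godd H"
  shows "godd (F * (G * H))"
proof -
  have card_eq: "card U = card S + card (U - S)" if "S \<subseteq> U" for S U :: "'a set"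
    using that by (simp add: card_Diff_subset card_mono)
  have "coeff (G * H) U = 0" if "odd (card U)" for U
    unfolding coeff_times
  proof (rule sum.neutral, rule ballI)
    fix S assume "S \<in> Pow U"
    then have "even (card S) \<or> even (card (U - S))"
      using card_eq[of S U] that by auto
    then show "(- 1) ^ inversions S (U - S) * coeff G S * coeff H (U - S) = 0"
      using assms by (auto simp: godd_def)
  qed
  note GH = this
  show ?thesis
    unfolding godd_def coeff_times[of F]
  proof (intro allI impI sum.neutral ballI)
    fix S U :: "'a set" assume "even (card U)" "S \<in> Pow U"
    then have "even (card S) \<or> odd (card (U - S))"
      using card_eq[of S U] by auto
    then show "(- 1) ^ inversions S (U - S) * coeff F S * coeff (G * H) (U - S) = 0"
      using assms GH by (auto simp: godd_def)
  qed
qed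

text \<open>The bound counts all generators, not only those integrated over. This suffices because
  it is applied to polynomials in \<open>theta2\<close> alone.\<close>

definition deg_le :: "nat \<Rightarrow> 'g::{finite,linorder} grassmann \<Rightarrow> bool" where
  "deg_le n F \<longleftrightarrow> (\<forall>S. n < card S \<longrightarrow> coeff F S = 0)"

lemma deg_le_mult:
  assumes "deg_le m F" "deg_le n G"
  shows "deg_le (m + n) (F * G)"
  unfolding deg_le_def coeff_times
proof (intro allI impI sum.neutral ballI)
  fix S U :: "'a set" assume "m + n < card U" "S \<in> Pow U"
  moreover from this have "card U = card S + card (U - S)"
    by (simp add: card_Diff_subset card_mono)
  ultimately have "m < card S \<or> n < card (U - S)" by linarith
  then show "(- 1) ^ inversions S (U - S) * coeff F S * coeff G (U - S) = 0"
    using assms by (auto simp: deg_le_def)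
qed

lemma deg_le_berezin1: "deg_le (Suc n) F \<Longrightarrow> deg_le n (berezin1 g F)"
  by (auto simp: deg_le_def coeff_berezin1)

text \<open>Each single integral lowers the degree by one, so three of them leave a constant, which
  the fourth annihilates.\<close>

lemma berezin4_eq_0:
  assumes "deg_le 3 F"
  shows "berezin4 p F = 0"
proof -
  have "deg_le 0 (berezin1 (p 3) (berezin1 (p 2) (berezin1 (p 1) F)))"
    using assms by (intro deg_le_berezin1) (simp add: numeral_3_eq_3)
  then show ?thesis
    unfolding berezin4_unfold berezin1_eq_0_iff deg_le_def
    by (metis card_gt_0_iff empty_iff finite)
qed

lemma delta4_free:
  "(\<And>A. berezin1 g (\<eta> A) = 0) \<Longrightarrow> berezin1 g (delta4 \<eta>) = 0"
  by (simp add: delta4_def berezin1_mult_eq_0)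

lemma berezin4_delta4_factor:
  assumes "\<And>A. godd (v A)" "\<And>A B. berezin1 (p B) (v A) = 0"
  shows "berezin4 p (delta4 v * F) = delta4 v * berezin4 p F"
  by (simp add: delta4_def mult.assoc berezin4_free_times assms)

lemma berezin4_delta4_gen:
  assumes "inj p"
  shows "berezin4 p (delta4 (\<lambda>A. gen (p A))) = 1"
proof -
  have "berezin1 g 1 = 0" for g :: 'a
    using berezin1_linear(6)[of g 1] by (simp add: gconst_simps)
  then show ?thesis
    using berezin4_delta4_times_free[of p "\<lambda>_. 0" 1] assms
    by (simp add: godd_simps berezin1_linear)
qed

lemma godd_cofactor:
  assumes "\<And>A. godd (v A)"
  shows "godd (cofactor v A)"
  using exhaust_4[of A] by (elim disjE) (simp_all add: cofactor_eq godd_mult3 godd_simps assms)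

lemma cofactor_free:
  assumes "\<And>A. berezin1 g (v A) = 0"
  shows "berezin1 g (cofactor v A) = 0"
  unfolding cofactor_def berezin1_linear berezin1_sum mult.assoc
  by (simp add: berezin1_mult_eq_0 assms)

text \<open>One component times a cofactor is zero or \<open>delta4 v\<close>, and a second
  component annihilates \<open>delta4 v\<close>; a cofactor supplies three components.\<close>

lemma cofactor_times_cofactor:
  fixes v :: "4 \<Rightarrow> 'g::{finite,linorder} grassmann"
  assumes odd: "\<And>A. godd (v A)"
  shows "cofactor v A * cofactor v B = 0"
proof -
  have "v C * delta4 v = 0" for C
    using delta4_times[of v C] delta4_central[of v "v C"] odd by metis
  then have *: "v C * (v D * cofactor v B) = 0" for C D
    using odd by (simp add: times_cofactor)
  show ?thesis
    using exhaust_4[of A] by (elim disjE) (simp_all add: cofactor_eq odd mult.assoc *)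
qed

section \<open>Linear forms in a Grassmann vector\<close>

definition lin :: "(4 \<Rightarrow> 'g::{finite,linorder} grassmann) \<Rightarrow> complex ^ 4 \<Rightarrow> 'g grassmann" where
  "lin v chi = (\<Sum>A\<in>UNIV. gconst (chi $ A) * v A)"

lemma lin_linear:
  "lin (\<lambda>A. v A + w A) chi = lin v chi + lin w chi" "lin (\<lambda>A. v A - w A) chi = lin v chi - lin w chi"
  "lin (\<lambda>A. gconst c * v A) chi = gconst c * lin v chi"
proof -
  have *: "gconst a * (gconst c * F) = gconst c * (gconst a * F)" for a and F :: "'a grassmann"
    by (simp add: mult.commute flip: mult.assoc gconst_simps)
  show "lin (\<lambda>A. v A + w A) chi = lin v chi + lin w chi" "lin (\<lambda>A. v A - w A) chi = lin v chi - lin w chi"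
    "lin (\<lambda>A. gconst c * v A) chi = gconst c * lin v chi"
    by (simp_all add: lin_def algebra_simps sum.distrib sum_subtractf sum_distrib_left *)
qed

lemma godd_lin: "(\<And>A. godd (v A)) \<Longrightarrow> godd (lin v chi)"
  unfolding lin_def by (intro godd_sum godd_simps)

lemma lin_free: "(\<And>A. berezin1 g (v A) = 0) \<Longrightarrow> berezin1 g (lin v chi) = 0"
  by (simp add: lin_def berezin1_sum berezin1_linear)

lemma lin_times_lin:
  "lin v chi * lin w \<xi> = (\<Sum>A\<in>UNIV. \<Sum>B\<in>UNIV. gconst (chi $ A * \<xi> $ B) * (v A * w B))"
proof -
  have "gconst a * F * (gconst b * G) = gconst (a * b) * (F * G)" for a b and F G :: "'a grassmann"
    by (metis gconst_commute gconst_simps(6) mult.assoc)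
  then show ?thesis by (simp add: lin_def sum_product)
qed

lemma deg_le_lin_gen: "deg_le 1 (lin (\<lambda>A. gen (p A)) chi)"
proof -
  have "coeff (gen g) S = 0" if "1 < card S" for g :: 'a and S
    using that by auto
  then show ?thesis
    by (simp add: deg_le_def lin_def coeff_sum coeff_gconst_times del: coeff_simps(7))
qed

lemma gconst_sum: "gconst (\<Sum>i\<in>I. c i) = (\<Sum>i\<in>I. gconst (c i))"
  by (induction I rule: infinite_finite_induct) (simp_all add: gconst_simps)

lemma lin_times_lin_cofactor:
  assumes "\<And>A. godd (v A)"
  shows "lin v chi * lin (cofactor v) \<xi> = gconst (\<Sum>A\<in>UNIV. \<xi> $ A * chi $ A) * delta4 v"
  by (simp add: lin_times_lin times_cofactor assms if_distrib gconst_sum sum_distrib_right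
      mult.commute[of "chi $ _"] cong: if_cong)

section \<open>The external wavefunctions and the expansion of their product\<close>

lemma wavefunction_plus_half_eq: "wavefunction_plus_half i chi = lin (psi i) chi"
  by (simp add: wavefunction_plus_half_def lin_def gconst_commute)

text \<open>The minus sign is that of the cyclic permutation carrying the free index of
  \<open>levi_civita\<close> from the last slot to the first.\<close>

lemma wavefunction_minus_half_eq: "wavefunction_minus_half i chi = - lin (cofactor (psi i)) chi"
proof -
  let ?t = "\<lambda>A B C D. gconst (levi_civita A B C D) * psi i A * psi i B * psi i C * gconst (chi $ D)"
  let ?P = "\<lambda>A B C. psi i A * (psi i B * psi i C)"
  have cyc: "levi_civita A B C D = - levi_civita D A B C" for A B C D
    by (metis levi_civita_antisymmetric minus_minus)
  have t: "?t A B C D = - (gconst (chi $ D) * (gconst (levi_civita D A B C) * ?P A B C))" for A B C D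
    by (simp add: cyc[of A B C D] gconst_simps gconst_commute mult.assoc)
  have "(\<Sum>A\<in>UNIV. \<Sum>B\<in>UNIV. \<Sum>C\<in>UNIV. \<Sum>D\<in>UNIV. ?t A B C D) =
      (\<Sum>A\<in>UNIV. \<Sum>B\<in>UNIV. \<Sum>D\<in>UNIV. \<Sum>C\<in>UNIV. ?t A B C D)"
    by (intro sum.cong refl sum.swap)
  also have "\<dots> = (\<Sum>A\<in>UNIV. \<Sum>D\<in>UNIV. \<Sum>B\<in>UNIV. \<Sum>C\<in>UNIV. ?t A B C D)"
    by (intro sum.cong refl sum.swap)
  also have "\<dots> = (\<Sum>D\<in>UNIV. \<Sum>A\<in>UNIV. \<Sum>B\<in>UNIV. \<Sum>C\<in>UNIV. ?t A B C D)"
    by (rule sum.swap)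
  also have "\<dots> = - lin (\<lambda>D. \<Sum>A\<in>UNIV. \<Sum>B\<in>UNIV. \<Sum>C\<in>UNIV.
      gconst (levi_civita D A B C) * ?P A B C) chi"
    unfolding t lin_def sum_negf sum_distrib_left ..
  finally have sum_eq: "(\<Sum>A\<in>UNIV. \<Sum>B\<in>UNIV. \<Sum>C\<in>UNIV. \<Sum>D\<in>UNIV. ?t A B C D) = \<dots>" .
  have "cofactor (psi i) = (\<lambda>D. gconst (1 / 6) * (\<Sum>A\<in>UNIV. \<Sum>B\<in>UNIV. \<Sum>C\<in>UNIV.
      gconst (levi_civita D A B C) * ?P A B C))"
    by (simp add: fun_eq_iff cofactor_def mult.assoc)
  then show ?thesis
    unfolding wavefunction_minus_half_def sum_eq by (simp add: lin_linear)
qed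

text \<open>
  Here \<open>a\<^sub>i + n\<^sub>i\<close> splits the wavefunction \<open>f\<^sub>i\<close> on the curve into its \<open>\<Psi>\<^sub>3\<close> part and its
  displacement, and \<open>- c\<close> is \<open>f\<^sub>3\<close>.  As \<open>c\<close> is cubic in \<open>\<Psi>\<^sub>3\<close>, exactly one factor \<open>a\<^sub>i\<close> survives
  besides the term without any.
\<close>

lemma odd_product_expansion:
  fixes a1 a2 a4 n1 n2 n4 c V :: "'g::{finite,linorder} grassmann"
  assumes a: "godd a1" "godd a2" "godd a4" and n: "godd n1" "godd n2" "godd n4" and c: "godd c"
    and ac: "a1 * c = gconst k1 * V" "a2 * c = gconst k2 * V" "a4 * c = gconst k4 * V"
    and aV: "a1 * V = 0" "a2 * V = 0"
  shows "(a1 + n1) * (a2 + n2) * (- c) * (a4 + n4) =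
    (gconst k4 * (n1 * n2) - gconst k2 * (n1 * n4) + gconst k1 * (n2 * n4)) * V + n1 * (n2 * n4) * c"
proof -
  have g: "x * (gconst k * y) = gconst k * (x * y)" for x y :: "'g grassmann" and k
    by (metis gconst_commute mult.assoc)
  have anti: "x * (y * z) = - (y * (x * z))" if "godd x" "godd y" for x y z :: "'g grassmann"
    by (simp add: godd_anticommute[OF that] flip: mult.assoc)
  note an = anti[OF a(2) n(3)] anti[OF a(1) n(2)] anti[OF a(1) n(3)]
  \<comment> \<open>Exchanging \<open>c\<close> with the last odd factor absorbs its sign and leaves
    \<open>c\<close> at the right end, where the \<open>a\<close> factors can reach it.\<close>
  have "(- c) * (a4 + n4) = (a4 + n4) * c"
    using godd_anticommute[OF c godd_simps(3)[OF a(3) n(3)]] by simp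
  then have "(a1 + n1) * (a2 + n2) * (- c) * (a4 + n4) = (a1 + n1) * ((a2 + n2) * ((a4 + n4) * c))"
    by (metis mult.assoc)
  also have "(a4 + n4) * c = gconst k4 * V + n4 * c"
    by (simp add: distrib_right ac)
  \<comment> \<open>A second factor \<open>a2\<close> meets \<open>V\<close> and vanishes; carrying
    \<open>a2\<close> past \<open>n4\<close> to reach \<open>c\<close> produces the minus sign of
    the \<open>k2\<close> term.\<close>
  also have "(a2 + n2) * \<dots> = gconst k4 * (n2 * V) - gconst k2 * (n4 * V) + n2 * (n4 * c)"
    by (simp add: algebra_simps g[of a1] g[of a2] g[of n1] g[of n2] g[of n4] an ac aV)
  also have "(a1 + n1) * \<dots> = gconst k4 * (n1 * (n2 * V)) - gconst k2 * (n1 * (n4 * V))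
      + gconst k1 * (n2 * (n4 * V)) + n1 * (n2 * (n4 * c))"
    by (simp add: algebra_simps g[of a1] g[of a2] g[of n1] g[of n2] g[of n4] an ac aV)
  finally show ?thesis
    by (simp add: algebra_simps)
qed

section \<open>Displacements along a curve and their products\<close>

definition dual_shift ::
    "complex ^ 4 ^ 4 \<Rightarrow> (4 \<Rightarrow> 'g::{finite,linorder} grassmann) \<Rightarrow> 4 \<Rightarrow> 'g grassmann" where
  "dual_shift M v A = (\<Sum>B\<in>UNIV. gconst (M $ A $ B) * cofactor v B)"

text \<open>
  On a curve of the family, \<open>\<Psi>\<^sub>i - \<Psi>\<^sub>3\<close> is the displacement with \<open>z = Z\<^sub>i - Z\<^sub>3\<close> and
  \<open>w = Z\<^sub>i\<^sup>2 - Z\<^sub>3\<^sup>2\<close> (no relation between the two is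
  needed before the final step).
\<close>

definition displacement ::
    "complex ^ 4 ^ 4 \<Rightarrow> (4 \<Rightarrow> 'g::{finite,linorder} grassmann) \<Rightarrow> complex \<Rightarrow> complex \<Rightarrow> 4 \<Rightarrow> 'g grassmann"
  where "displacement M v z w A = gconst w * dual_shift M v A - gconst z * v A"

lemma godd_dual_shift: "(\<And>A. godd (v A)) \<Longrightarrow> godd (dual_shift M v A)"
  unfolding dual_shift_def by (intro godd_sum godd_simps godd_cofactor)

lemma dual_shift_free: "(\<And>A. berezin1 g (v A) = 0) \<Longrightarrow> berezin1 g (dual_shift M v A) = 0"
  by (simp add: dual_shift_def berezin1_sum berezin1_linear cofactor_free)

lemma godd_displacement: "(\<And>A. godd (v A)) \<Longrightarrow> godd (displacement M v z w A)"
  unfolding displacement_def by (intro godd_simps godd_dual_shift)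

lemma displacement_free: "(\<And>A. berezin1 g (v A) = 0) \<Longrightarrow> berezin1 g (displacement M v z w A) = 0"
  by (simp add: displacement_def berezin1_linear dual_shift_free)

definition contract :: "complex ^ 4 \<Rightarrow> complex ^ 4 ^ 4 \<Rightarrow> complex ^ 4 \<Rightarrow> complex" where
  "contract chi M \<xi> = (\<Sum>A\<in>UNIV. \<Sum>B\<in>UNIV. chi $ A * M $ A $ B * \<xi> $ B)"

lemma gconst_mult_gconst_mult:
  "gconst a * F * (gconst b * G) = gconst (a * b) * (F * G)"
  by (metis gconst_commute gconst_simps(6) mult.assoc)

lemma gconst_gconst_mult: "gconst a * (gconst b * F) = gconst (a * b) * F"
  by (simp add: gconst_simps mult.assoc)

text \<open>Each \<open>v A\<close> selects its own cofactor and leaves \<open>M $ B $ A\<close>;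
  the symmetry of \<open>M\<close> restores the index order of \<open>contract\<close>.\<close>

lemma lin_times_lin_dual_shift:
  assumes odd: "\<And>A. godd (v A)" and sym: "\<And>A B. M $ A $ B = M $ B $ A"
  shows "lin v chi * lin (dual_shift M v) \<xi> = gconst (contract chi M \<xi>) * delta4 v"
proof -
  have "v A * dual_shift M v B = gconst (M $ B $ A) * delta4 v" for A B
  proof -
    have "v A * dual_shift M v B = (\<Sum>C\<in>UNIV. gconst (M $ B $ C) * (v A * cofactor v C))"
      unfolding dual_shift_def sum_distrib_left
      by (intro sum.cong refl) (metis gconst_commute mult.assoc)
    then show ?thesis by (simp add: times_cofactor odd if_distrib cong: if_cong)
  qed
  then have "lin v chi * lin (dual_shift M v) \<xi> =
      (\<Sum>A\<in>UNIV. \<Sum>B\<in>UNIV. gconst (chi $ A * M $ A $ B * \<xi> $ B) * delta4 v)"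
    unfolding lin_times_lin
    by (intro sum.cong refl) (simp add: gconst_gconst_mult sym mult_ac)
  then show ?thesis by (simp add: contract_def gconst_sum sum_distrib_right)
qed

lemma contract_commute:
  assumes "\<And>A B. M $ A $ B = M $ B $ A"
  shows "contract \<xi> M chi = contract chi M \<xi>"
  unfolding contract_def
  by (subst sum.swap) (intro sum.cong refl, simp add: assms mult_ac)

lemma lin_dual_shift_times_lin:
  assumes odd: "\<And>A. godd (v A)" and sym: "\<And>A B. M $ A $ B = M $ B $ A"
  shows "lin (dual_shift M v) chi * lin v \<xi> = - (gconst (contract chi M \<xi>) * delta4 v)"
proof -
  have "lin (dual_shift M v) chi * lin v \<xi> = - (lin v \<xi> * lin (dual_shift M v) chi)"
    by (intro godd_anticommute godd_lin godd_dual_shift odd)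
  then show ?thesis
    using lin_times_lin_dual_shift[OF assms, where chi = \<xi> and \<xi> = chi] contract_commute[OF sym] by simp
qed

lemma lin_dual_shift_times_lin_dual_shift:
  assumes odd: "\<And>A. godd (v A)"
  shows "lin (dual_shift M v) chi * lin (dual_shift M v) \<xi> = 0"
proof -
  have "dual_shift M v A * dual_shift M v B = 0" for A B
    unfolding dual_shift_def sum_product gconst_mult_gconst_mult
    by (simp add: cofactor_times_cofactor odd)
  then show ?thesis by (simp add: lin_times_lin)
qed

lemma lin_displacement:
  "lin (displacement M v z w) chi = gconst w * lin (dual_shift M v) chi - gconst z * lin v chi"
  unfolding displacement_def by (simp only: lin_linear)

text \<open>The two mixed terms have the same contraction because \<open>M\<close> is symmetric, and
  opposite signs because the linear forms are odd. Hence the antisymmetric combination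
  \<open>w * z' - z * w'\<close>.\<close>

lemma lin_displacement_mult:
  assumes "\<And>A. godd (v A)" and "\<And>A B. M $ A $ B = M $ B $ A"
  shows "lin (displacement M v z w) chi * lin (displacement M v z' w') \<xi> =
    gconst (z * z') * (lin v chi * lin v \<xi>) +
    gconst ((w * z' - z * w') * contract chi M \<xi>) * delta4 v"
  unfolding lin_displacement left_diff_distrib right_diff_distrib gconst_mult_gconst_mult
    lin_times_lin_dual_shift[OF assms] lin_dual_shift_times_lin[OF assms]
    lin_dual_shift_times_lin_dual_shift[OF assms(1)]
  by (rule grassmann_eqI) (simp add: coeff_gconst_times algebra_simps)

lemma lin_times_delta4:
  assumes "\<And>A. godd (v A)"
  shows "lin v chi * delta4 v = 0"
proof -
  have "v A * delta4 v = 0" for A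
    using delta4_times[of v A] delta4_central[of v "v A"] assms by metis
  then show ?thesis by (simp add: lin_def sum_distrib_right mult.assoc)
qed

text \<open>\<open>delta4 v\<close> itself contains a cofactor, as
  \<open>v 1 * cofactor v 1\<close>, and two cofactors multiply to zero.\<close>

lemma lin_dual_shift_times_delta4:
  assumes "\<And>A. godd (v A)"
  shows "lin (dual_shift M v) chi * delta4 v = 0"
proof -
  have *: "cofactor v A * (v 1 * F) = - (v 1 * cofactor v A * F)" for A F
  proof -
    have "cofactor v A * v 1 = - (v 1 * cofactor v A)"
      by (intro godd_anticommute godd_cofactor assms)
    then show ?thesis by (simp flip: mult.assoc)
  qed
  have "cofactor v A * delta4 v = 0" for A
  proof -
    have "cofactor v A * delta4 v = cofactor v A * (v 1 * cofactor v 1)"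
      by (simp add: times_cofactor assms)
    also have "\<dots> = 0"
      by (simp add: * mult.assoc cofactor_times_cofactor assms)
    finally show ?thesis .
  qed
  then show ?thesis by (simp add: lin_def dual_shift_def sum_distrib_right mult.assoc)
qed

text \<open>One cubic shift together with two further linear forms has degree at least five in four
  odd components, so only the purely linear parts survive.\<close>

lemma lin_displacement_mult3:
  assumes odd: "\<And>A. godd (v A)" and sym: "\<And>A B. M $ A $ B = M $ B $ A"
  shows "lin (displacement M v z w) chi *
      (lin (displacement M v z' w') \<xi> * lin (displacement M v z'' w'') \<zeta>) =
    - (gconst (z * z' * z'') * (lin v chi * (lin v \<xi> * lin v \<zeta>)))"
proof -
  have V: "lin (displacement M v z w) chi * (gconst c * delta4 v) = 0" for c
    by (simp add: lin_displacement left_diff_distrib gconst_mult_gconst_mult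
        lin_times_delta4 lin_dual_shift_times_delta4 odd)
  have t: "lin (dual_shift M v) chi * (lin v \<xi> * lin v \<zeta>) = 0"
  proof -
    have "delta4 v * lin v \<zeta> = 0"
      using lin_times_delta4[of v \<zeta>] delta4_central[of v "lin v \<zeta>"] odd by metis
    then show ?thesis
      unfolding mult.assoc[symmetric] lin_dual_shift_times_lin[OF assms]
      by (simp add: mult.assoc)
  qed
  show ?thesis
    unfolding lin_displacement_mult[OF assms, where chi = \<xi>] distrib_left V
    by (simp add: lin_displacement left_diff_distrib gconst_mult_gconst_mult t mult.assoc[of z])
qed

section \<open>The integrals over \<open>Psi 3\<close> and \<open>theta2\<close>\<close>

text \<open>This evaluates what remains once the delta functions are used up. The
  \<open>Psi 3\<close> integral is saturated by \<open>V\<close>, the \<open>theta2\<close> integral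
  by a pair of displacements.\<close>

lemma berezin_product:
  fixes M :: "complex ^ 4 ^ 4" and z w :: "4 \<Rightarrow> complex"
  assumes sym: "\<And>A B. M $ A $ B = M $ B $ A"
  defines "u \<equiv> \<lambda>i A. psi 3 A + displacement M (\<lambda>A. theta2 A) (z i) (w i) A"
  defines "m \<equiv> \<lambda>i j chi \<xi>. (w i * z j - z i * w j) * contract chi M \<xi>"
  shows "berezin4 (Psi 3) (berezin4 Theta2
      (lin (u 1) chi1 * lin (u 2) chi2 * (- lin (cofactor (psi 3)) chi3) * lin (u 4) chi4)) =
    gconst (m 1 2 chi1 chi2 * (\<Sum>A\<in>UNIV. chi3 $ A * chi4 $ A)
      + m 2 4 chi2 chi4 * (\<Sum>A\<in>UNIV. chi3 $ A * chi1 $ A)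
      - m 1 4 chi1 chi4 * (\<Sum>A\<in>UNIV. chi3 $ A * chi2 $ A))"
proof -
  define \<theta> :: "4 \<Rightarrow> generator grassmann" where "\<theta> = (\<lambda>A. theta2 A)"
  define c where "c = lin (cofactor (psi 3)) chi3"
  define V where "V = delta4 (\<lambda>A. psi 3 A)"
  define n where "n i chi = lin (displacement M \<theta> (z i) (w i)) chi" for i chi
  define k where "k \<xi> = (\<Sum>A\<in>UNIV. chi3 $ A * \<xi> $ A)" for \<xi> :: "complex ^ 4"
  have odd_\<theta>: "godd (\<theta> A)" and odd_\<psi>: "godd (psi 3 A)" for A
    by (simp_all add: \<theta>_def godd_simps)
  have odd_c: "godd c" unfolding c_def by (intro godd_lin godd_cofactor odd_\<psi>)
  have odd_n: "godd (n i chi)" for i chi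
    unfolding n_def by (intro godd_lin godd_displacement odd_\<theta>)
  have u: "lin (u i) chi = lin (psi 3) chi + n i chi" for i chi
    by (simp add: u_def n_def \<theta>_def lin_linear)
  have nn: "n i chi * n j \<xi> = gconst (z i * z j) * (lin \<theta> chi * lin \<theta> \<xi>) + gconst (m i j chi \<xi>) * delta4 \<theta>"
    for i j chi \<xi>
    unfolding n_def m_def by (rule lin_displacement_mult[OF odd_\<theta> sym])
  have nnn: "n 1 chi1 * (n 2 chi2 * n 4 chi4) =
      - (gconst (z 1 * z 2 * z 4) * (lin \<theta> chi1 * (lin \<theta> chi2 * lin \<theta> chi4)))"
    unfolding n_def by (rule lin_displacement_mult3[OF odd_\<theta> sym])
  have deg1: "deg_le 1 (lin \<theta> chi)" for chi
    unfolding \<theta>_def by (rule deg_le_lin_gen)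
  have deg2: "deg_le 2 (lin \<theta> chi * lin \<theta> \<xi>)" for chi \<xi>
    using deg_le_mult[OF deg1 deg1, of chi \<xi>] by (simp add: numeral_2_eq_2)
  have deg3: "deg_le 3 (lin \<theta> chi * (lin \<theta> \<xi> * lin \<theta> \<zeta>))" for chi \<xi> \<zeta>
    using deg_le_mult[OF deg1 deg2, of chi \<xi> \<zeta>] by (simp add: numeral_3_eq_3)
  \<comment> \<open>The quadratic part of \<open>nn\<close> has too low a degree to contribute, and
    \<open>delta4 \<theta>\<close> integrates to one.\<close>
  have int_\<theta>: "berezin4 Theta2 (n i chi * n j \<xi>) = gconst (m i j chi \<xi>)" for i j chi \<xi>
  proof -
    have "deg_le 3 (lin \<theta> chi * lin \<theta> \<xi>)"
      using deg2[of chi \<xi>] by (simp add: deg_le_def)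
    moreover have "berezin4 Theta2 (delta4 \<theta>) = 1"
      unfolding \<theta>_def by (rule berezin4_delta4_gen) (simp add: inj_def)
    ultimately show ?thesis
      unfolding nn berezin4_linear by (simp add: berezin4_eq_0)
  qed
  have int_\<theta>3: "berezin4 Theta2 (n 1 chi1 * (n 2 chi2 * n 4 chi4)) = 0"
    unfolding nnn berezin4_linear by (simp add: berezin4_eq_0 deg3)
  have int_V: "berezin4 Theta2 (F * V) = berezin4 Theta2 F * V" for F
  proof -
    have V: "V * F = F * V" for F
      unfolding V_def by (intro delta4_central odd_\<psi>)
    have "berezin4 Theta2 (V * F) = V * berezin4 Theta2 F"
      unfolding V_def by (rule berezin4_delta4_factor) (simp_all add: godd_simps berezin1_gen)
    then show ?thesis by (simp only: V)
  qed
  \<comment> \<open>The term without \<open>V\<close> is cubic in \<open>theta2\<close>, so it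
    integrates to zero after the odd factor \<open>c\<close>, which is free of
    \<open>theta2\<close>, is moved out to the left.\<close>
  have int_c: "berezin4 Theta2 (n 1 chi1 * (n 2 chi2 * n 4 chi4) * c) = 0"
  proof -
    have "godd (n 1 chi1 * (n 2 chi2 * n 4 chi4))"
      by (intro godd_mult3 odd_n)
    then have "n 1 chi1 * (n 2 chi2 * n 4 chi4) * c = - (c * (n 1 chi1 * (n 2 chi2 * n 4 chi4)))"
      by (rule godd_anticommute[OF _ odd_c])
    moreover have "berezin1 (Theta2 A) c = 0" for A
      unfolding c_def by (intro lin_free cofactor_free) (simp add: berezin1_gen)
    ultimately show ?thesis
      by (simp add: berezin4_linear berezin4_free_times odd_c int_\<theta>3)
  qed
  have "lin (u 1) chi1 * lin (u 2) chi2 * (- c) * lin (u 4) chi4 =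
    (gconst (k chi4) * (n 1 chi1 * n 2 chi2) - gconst (k chi2) * (n 1 chi1 * n 4 chi4)
      + gconst (k chi1) * (n 2 chi2 * n 4 chi4)) * V + n 1 chi1 * (n 2 chi2 * n 4 chi4) * c"
    unfolding u
  proof (rule odd_product_expansion)
    show "lin (psi 3) chi1 * c = gconst (k chi1) * V" "lin (psi 3) chi2 * c = gconst (k chi2) * V"
      "lin (psi 3) chi4 * c = gconst (k chi4) * V"
      unfolding c_def k_def V_def by (rule lin_times_lin_cofactor[OF odd_\<psi>])+
    show "lin (psi 3) chi1 * V = 0" "lin (psi 3) chi2 * V = 0"
      unfolding V_def by (rule lin_times_delta4[OF odd_\<psi>])+
  qed (intro odd_n odd_c godd_lin odd_\<psi>)+
  then have "berezin4 Theta2 (lin (u 1) chi1 * lin (u 2) chi2 * (- c) * lin (u 4) chi4) =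
      gconst (k chi4 * m 1 2 chi1 chi2 - k chi2 * m 1 4 chi1 chi4 + k chi1 * m 2 4 chi2 chi4) * V"
    by (simp only: berezin4_linear int_V int_\<theta> int_c) (simp add: gconst_simps)
  moreover have "berezin4 (Psi 3) V = 1"
    unfolding V_def by (rule berezin4_delta4_gen) (simp add: inj_def)
  ultimately show ?thesis
    by (simp add: berezin4_linear c_def k_def algebra_simps)
qed

section \<open>The integral over the moduli\<close>

lemma central_lin_cong:
  assumes "\<And>F. D * F = F * D" "\<And>A. D * v A = D * w A"
  shows "D * lin v chi = D * lin w chi"
  unfolding lin_def sum_distrib_left by (intro sum.cong refl central_times_cong assms)

text \<open>A delta function is annihilated by each component of its own argument, so next to it
  \<open>gen (p A)\<close> and \<open>v A\<close> are interchangeable.\<close>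

lemma delta4_gen_diff_times_lin:
  assumes "\<And>A. godd (v A)"
  shows "delta4 (\<lambda>A. gen (p A) - v A) * lin (\<lambda>A. gen (p A)) chi =
    delta4 (\<lambda>A. gen (p A) - v A) * lin v chi"
proof -
  have odd: "godd (gen (p A) - v A)" for A by (intro godd_simps assms)
  have "delta4 (\<lambda>A. gen (p A) - v A) * (gen (p A) - v A) = 0" for A
    using delta4_times[of "\<lambda>A. gen (p A) - v A" A] odd by simp
  then show ?thesis
    by (intro central_lin_cong delta4_central odd) (simp add: right_diff_distrib)
qed

definition moduli_constraint :: "complex ^ 4 ^ 4 \<Rightarrow> complex ^ 4 \<Rightarrow> 4 \<Rightarrow> 4 \<Rightarrow> generator grassmann" where
  "moduli_constraint M Z i A = psi i A + theta1 A + gconst (Z $ i) * theta2 A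
     - gconst ((Z $ i)\<^sup>2) * dual_shift M (\<lambda>A. theta2 A) A"

lemma curve_delta_eq: "curve_delta M Z i = delta4 (moduli_constraint M Z i)"
proof -
  have "gconst (1 / 6) * (\<Sum>B\<in>UNIV. \<Sum>C\<in>UNIV. \<Sum>D\<in>UNIV. \<Sum>E\<in>UNIV.
      gconst (M $ A $ B * levi_civita B C D E) * theta2 C * theta2 D * theta2 E) =
    dual_shift M (\<lambda>A. theta2 A) A" for A
    by (rule grassmann_eqI)
      (simp add: dual_shift_def cofactor_def coeff_gconst_times coeff_sum sum_distrib_left
        mult.assoc gconst_simps mult.left_commute)
  then show ?thesis
    unfolding curve_delta_def moduli_constraint_def
    by (intro arg_cong[where f = delta4] ext) (simp add: gconst_commute)
qed

lemma godd_moduli_constraint: "godd (moduli_constraint M Z i A)"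
  unfolding moduli_constraint_def by (intro godd_simps godd_dual_shift)

text \<open>\<open>theta1\<close> enters all constraints with the same coefficient and cancels in
  differences.\<close>

lemma moduli_constraint_diff:
  "moduli_constraint M Z i A - moduli_constraint M Z j A = psi i A -
    (psi j A + displacement M (\<lambda>A. theta2 A) (Z $ i - Z $ j) ((Z $ i)\<^sup>2 - (Z $ j)\<^sup>2) A)"
  by (simp add: moduli_constraint_def displacement_def gconst_simps algebra_simps)

lemma int_d8theta_eq: "int_d8theta F = berezin4 Theta2 (berezin4 Theta1 F)"
  by (simp add: int_d8theta_def berezin4_def berezin_def)

text \<open>The third delta function eliminates \<open>theta1\<close>. The other three become
  conditions relative to the point \<open>psi 3\<close>.\<close>

lemma int_d8theta_curve_delta_times:
  fixes M :: "complex ^ 4 ^ 4" and Z :: "complex ^ 4"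
  defines "d \<equiv> \<lambda>i. delta4 (\<lambda>A. psi i A -
    (psi 3 A + displacement M (\<lambda>A. theta2 A) (Z $ i - Z $ 3) ((Z $ i)\<^sup>2 - (Z $ 3)\<^sup>2) A))"
  assumes X: "\<And>A. berezin1 (Theta1 A) X = 0"
  shows "int_d8theta (curve_delta M Z 1 * curve_delta M Z 2 * curve_delta M Z 3 * curve_delta M Z 4 * X) =
    berezin4 Theta2 (d 1 * (d 2 * (d 4 * X)))"
proof -
  let ?D = "curve_delta M Z"
  \<comment> \<open>The value of \<open>theta1\<close> that solves the third constraint.\<close>
  let ?v = "\<lambda>A. - (psi 3 A + gconst (Z $ 3) * theta2 A
      - gconst ((Z $ 3)\<^sup>2) * dual_shift M (\<lambda>A. theta2 A) A)"
  have central: "?D i * F = F * ?D i" for i F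
    unfolding curve_delta_eq by (intro delta4_central godd_moduli_constraint)
  \<comment> \<open>Next to \<open>?D 3\<close> the third constraint counts as zero, so it may be
    subtracted from the others.\<close>
  have d: "?D 3 * ?D i = ?D 3 * d i" for i
    unfolding d_def curve_delta_eq[of M Z i] moduli_constraint_diff[symmetric]
  proof (intro central_delta4_cong central)
    show "?D 3 * moduli_constraint M Z i A =
        ?D 3 * (moduli_constraint M Z i A - moduli_constraint M Z 3 A)" for A
      unfolding curve_delta_eq right_diff_distrib
      by (subst delta4_times) (simp_all add: godd_moduli_constraint)
  qed
  have "?D 1 * ?D 2 * ?D 3 * ?D 4 * X = ?D 3 * (?D 1 * ?D 2) * (?D 4 * X)"
    by (simp only: central[of 3 "?D 1 * ?D 2"] mult.assoc)
  also have "\<dots> = ?D 3 * (?D 1 * (?D 2 * (?D 4 * X)))"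
    by (simp only: mult.assoc)
  also have "\<dots> = ?D 3 * (d 1 * (d 2 * (d 4 * X)))"
    by (intro central_times_cong central d refl)
  also have "\<dots> = delta4 (\<lambda>A. gen (Theta1 A) - ?v A) * (d 1 * (d 2 * (d 4 * X)))"
    unfolding curve_delta_eq moduli_constraint_def
    by (intro arg_cong[where f = "\<lambda>\<eta>. delta4 \<eta> * _"] ext) (simp add: algebra_simps)
  also have "berezin4 Theta1 \<dots> = d 1 * (d 2 * (d 4 * X))"
  proof (rule berezin4_delta4_times_free)
    show "godd (?v A)" for A
      by (intro godd_simps godd_dual_shift)
    show "berezin1 (Theta1 B) (?v A) = 0" for A B
      by (simp add: berezin1_linear berezin1_gen dual_shift_free)
    show "berezin1 (Theta1 B) (d 1 * (d 2 * (d 4 * X))) = 0" for B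
      unfolding d_def
      by (intro berezin1_mult_eq_0 delta4_free X)
        (simp_all add: berezin1_linear berezin1_gen displacement_free)
  qed (simp add: inj_def)
  finally show ?thesis by (simp only: int_d8theta_eq)
qed

text \<open>Each of \<open>d 1\<close>, \<open>d 2\<close>, \<open>d 4\<close> is consumed by the
  integral over its own variables, after exchanging fourfold integrals. No delta function is left
  for \<open>Psi 3\<close>, so that integral stays.\<close>

lemma int_d4psi_curve_delta_times:
  fixes u :: "4 \<Rightarrow> 4 \<Rightarrow> generator grassmann"
  defines "d \<equiv> \<lambda>i. delta4 (\<lambda>A. psi i A - u i A)"
  assumes odd: "\<And>i A. godd (u i A)"
    and u_free: "\<And>i j A B. j \<noteq> 3 \<Longrightarrow> berezin1 (Psi j B) (u i A) = 0"
    and X_free: "\<And>j B. j \<noteq> 3 \<Longrightarrow> berezin1 (Psi j B) X = 0"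
  shows "int_d4psi 1 (int_d4psi 2 (int_d4psi 3 (int_d4psi 4 (berezin4 p (d 1 * (d 2 * (d 4 * X))))))) =
    berezin4 (Psi 3) (berezin4 p X)"
proof -
  have odd': "godd (psi i A - u i A)" for i A
    by (intro godd_simps odd)
  have central: "d i * F = F * d i" for i F
    unfolding d_def by (intro delta4_central odd')
  have d_free: "berezin1 (Psi j B) (d i) = 0" if "j \<noteq> 3" "j \<noteq> i" for i j B
    unfolding d_def using that by (intro delta4_free) (simp add: berezin1_linear berezin1_gen u_free)
  have sift: "berezin4 (Psi i) (d i * F) = F" if "i \<noteq> 3" "\<And>B. berezin1 (Psi i B) F = 0" for i F
    unfolding d_def using that
    by (intro berezin4_delta4_times_free) (simp_all add: inj_def odd u_free)
  have "d 1 * (d 2 * (d 4 * X)) = d 4 * (d 1 * d 2) * X"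
    by (simp only: central[of 4 "d 1 * d 2"] mult.assoc)
  then have "d 1 * (d 2 * (d 4 * X)) = d 4 * (d 2 * (d 1 * X))"
    by (simp only: central[of 1 "d 2"] mult.assoc)
  then have 4: "berezin4 (Psi 4) (d 1 * (d 2 * (d 4 * X))) = d 2 * (d 1 * X)"
    by (simp add: sift berezin1_mult_eq_0 d_free X_free)
  have 2: "berezin4 (Psi 2) (d 2 * (d 1 * X)) = d 1 * X"
    and 1: "berezin4 (Psi 1) (d 1 * X) = X"
    by (simp_all add: sift berezin1_mult_eq_0 d_free X_free)
  show ?thesis
    unfolding int_d4psi_def berezin4_commute[of "Psi 4" p] 4
      berezin4_commute[of "Psi 2" "Psi 3"] berezin4_commute[of "Psi 2" p] 2
      berezin4_commute[of "Psi 1" "Psi 3"] berezin4_commute[of "Psi 1" p] 1 ..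
qed

theorem mainTheorem3:
  fixes M :: "complex ^ 4 ^ 4" and Z :: "complex ^ 4" and g :: complex
    and chi1 chi2 chi3 chi4 :: "complex ^ 4"
  assumes M_symmetric: "\<And>A B. M $ A $ B = M $ B $ A"
    and Z_distinct: "\<And>i j. i \<noteq> j \<Longrightarrow> Z $ i \<noteq> Z $ j"
  shows "gconst (2 * \<i> * g\<^sup>2) *
      int_d4psi 1 (int_d4psi 2 (int_d4psi 3 (int_d4psi 4 (int_d8theta (
        curve_delta M Z 1 * curve_delta M Z 2 * curve_delta M Z 3 * curve_delta M Z 4 *
        (wavefunction_plus_half 1 chi1 * wavefunction_plus_half 2 chi2 *
         wavefunction_minus_half 3 chi3 * wavefunction_plus_half 4 chi4) *
        gconst (1 / (\<Prod>i\<in>UNIV. angle Z i (i + 1)))))))) =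
    gconst (2 * \<i> * g\<^sup>2 / (\<Prod>i\<in>UNIV. angle Z i (i + 1)) *
      ((\<Sum>A\<in>UNIV. \<Sum>B\<in>UNIV. chi1 $ A * M $ A $ B * chi2 $ B) * (\<Sum>C\<in>UNIV. chi3 $ C * chi4 $ C) *
         angle Z 1 2 * angle Z 2 3 * angle Z 3 1 +
       (\<Sum>A\<in>UNIV. chi1 $ A * chi3 $ A) * (\<Sum>B\<in>UNIV. \<Sum>D\<in>UNIV. chi2 $ B * M $ B $ D * chi4 $ D) *
         angle Z 2 4 * angle Z 2 3 * angle Z 3 4 +
       (\<Sum>B\<in>UNIV. chi2 $ B * chi3 $ B) * (\<Sum>A\<in>UNIV. \<Sum>D\<in>UNIV. chi1 $ A * M $ A $ D * chi4 $ D) *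
         angle Z 4 1 * angle Z 1 3 * angle Z 3 4))"
proof -
  define z w where "z i = Z $ i - Z $ 3" and "w i = (Z $ i)\<^sup>2 - (Z $ 3)\<^sup>2" for i
  define u where "u i A = psi 3 A + displacement M (\<lambda>A. theta2 A) (z i) (w i) A" for i A
  define d where "d i = delta4 (\<lambda>A. psi i A - u i A)" for i
  define c where "c = 1 / (\<Prod>i\<in>UNIV. angle Z i (i + 1))"
  define f where "f v1 v2 v4 = lin v1 chi1 * lin v2 chi2 * (- lin (cofactor (psi 3)) chi3) * lin v4 chi4"
    for v1 v2 v4 :: "4 \<Rightarrow> generator grassmann"
  have odd_u: "godd (u i A)" for i A
    unfolding u_def by (intro godd_simps godd_displacement)
  have central: "d i * F = F * d i" for i F
    unfolding d_def by (intro delta4_central godd_simps odd_u)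
  \<comment> \<open>The three delta functions left after the \<open>theta1\<close> integral, treated
    as one central element under which the wavefunctions are rewritten.\<close>
  define E where "E = d 1 * (d 2 * d 4)"
  have E_central: "E * F = F * E" for F
    unfolding E_def by (metis central mult.assoc)
  have d_lin: "d i * lin (psi i) chi = d i * lin (u i) chi" for i chi
    unfolding d_def by (intro delta4_gen_diff_times_lin odd_u)
  have E_lin: "E * lin (psi 1) chi = E * lin (u 1) chi" "E * lin (psi 2) chi = E * lin (u 2) chi"
    "E * lin (psi 4) chi = E * lin (u 4) chi" for chi
  proof -
    have E: "E = d 2 * d 4 * d 1" "E = d 1 * d 4 * d 2" "E = d 1 * d 2 * d 4"
      unfolding E_def
      by (rule central, simp only: central[of 2 "d 4"] mult.assoc, simp only: mult.assoc)
    show "E * lin (psi 1) chi = E * lin (u 1) chi"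
      unfolding E(1) mult.assoc d_lin ..
    show "E * lin (psi 2) chi = E * lin (u 2) chi"
      unfolding E(2) mult.assoc d_lin ..
    show "E * lin (psi 4) chi = E * lin (u 4) chi"
      unfolding E(3) mult.assoc d_lin ..
  qed
  \<comment> \<open>Particles 1, 2 and 4 are placed on the curve; the third wavefunction already
    depends on the base point \<open>psi 3\<close> only.\<close>
  have "E * (f (psi 1) (psi 2) (psi 4) * gconst c) = E * (f (u 1) (u 2) (u 4) * gconst c)"
    unfolding f_def by (intro central_times_cong E_central E_lin refl)
  then have swap: "d 1 * (d 2 * (d 4 * (f (psi 1) (psi 2) (psi 4) * gconst c))) =
      d 1 * (d 2 * (d 4 * (f (u 1) (u 2) (u 4) * gconst c)))"
    by (simp only: E_def mult.assoc)
  let ?I = "int_d4psi 1 (int_d4psi 2 (int_d4psi 3 (int_d4psi 4 (int_d8theta (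
        curve_delta M Z 1 * curve_delta M Z 2 * curve_delta M Z 3 * curve_delta M Z 4 *
        (wavefunction_plus_half 1 chi1 * wavefunction_plus_half 2 chi2 *
         wavefunction_minus_half 3 chi3 * wavefunction_plus_half 4 chi4) * gconst c)))))"
  have "int_d8theta (curve_delta M Z 1 * curve_delta M Z 2 * curve_delta M Z 3 * curve_delta M Z 4 *
      (f (psi 1) (psi 2) (psi 4) * gconst c)) =
    berezin4 Theta2 (d 1 * (d 2 * (d 4 * (f (psi 1) (psi 2) (psi 4) * gconst c))))"
    unfolding d_def u_def z_def w_def
  proof (rule int_d8theta_curve_delta_times)
    show "berezin1 (Theta1 A) (f (psi 1) (psi 2) (psi 4) * gconst c) = 0" for A
      unfolding f_def
      by (simp add: berezin1_mult_eq_0 berezin1_linear lin_free cofactor_free berezin1_gen)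
  qed
  then have "?I = int_d4psi 1 (int_d4psi 2 (int_d4psi 3 (int_d4psi 4 (berezin4 Theta2
      (d 1 * (d 2 * (d 4 * (f (u 1) (u 2) (u 4) * gconst c))))))))"
    unfolding wavefunction_plus_half_eq wavefunction_minus_half_eq swap
    by (simp only: f_def mult.assoc)
  also have "\<dots> = berezin4 (Psi 3) (berezin4 Theta2 (f (u 1) (u 2) (u 4) * gconst c))"
    unfolding d_def
  proof (rule int_d4psi_curve_delta_times)
    show u_free: "berezin1 (Psi j B) (u i A) = 0" if "j \<noteq> 3" for i j A B
      unfolding u_def using that
      by (simp add: berezin1_linear berezin1_gen displacement_free)
    show "berezin1 (Psi j B) (f (u 1) (u 2) (u 4) * gconst c) = 0" if "j \<noteq> 3" for j B
      unfolding f_def using that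
      by (simp add: berezin1_mult_eq_0 berezin1_linear lin_free cofactor_free berezin1_gen u_free)
  qed (rule odd_u)
  also have "\<dots> = gconst c * berezin4 (Psi 3) (berezin4 Theta2 (f (u 1) (u 2) (u 4)))"
    by (simp add: gconst_commute berezin4_linear)
  finally have I: "?I = gconst c * berezin4 (Psi 3) (berezin4 Theta2 (f (u 1) (u 2) (u 4)))" .
  \<comment> \<open>Here the relation between \<open>z\<close> and \<open>w\<close> enters: as a
    difference of squares, \<open>w i\<close> is \<open>z i * (Z $ i + Z $ 3)\<close>.\<close>
  have factor: "w i * z j - z i * w j = z i * z j * (Z $ i - Z $ j)" for i j
    by (simp add: z_def w_def power2_eq_square algebra_simps)
  \<comment> \<open>\<open>z i\<close> equals \<open>angle Z 3 i\<close> and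
    \<open>Z $ i - Z $ j\<close> equals \<open>angle Z j i\<close>; reversing brackets accounts for
    all signs, including the minus before the last term on the left.\<close>
  have spinors: "z 1 * z 2 * (Z $ 1 - Z $ 2) * m12 * k4 + z 2 * z 4 * (Z $ 2 - Z $ 4) * m24 * k1
      - z 1 * z 4 * (Z $ 1 - Z $ 4) * m14 * k2 =
    m12 * k4 * angle Z 1 2 * angle Z 2 3 * angle Z 3 1 + k1 * m24 * angle Z 2 4 * angle Z 2 3 * angle Z 3 4
      + k2 * m14 * angle Z 4 1 * angle Z 1 3 * angle Z 3 4" for m12 m14 m24 k1 k2 k4
    by (simp add: z_def angle_def algebra_simps)
  have quotient: "x / (\<Prod>i\<in>UNIV. angle Z i (i + 1)) = x * c" for x
    by (simp add: c_def)
  have contract_chi3: "(\<Sum>A\<in>UNIV. \<xi> $ A * chi3 $ A) = (\<Sum>A\<in>UNIV. chi3 $ A * \<xi> $ A)"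
    for \<xi> :: "complex ^ 4"
    by (simp add: mult.commute)
  show ?thesis
    unfolding c_def[symmetric] I f_def u_def
    unfolding berezin_product[OF M_symmetric] factor gconst_gconst_mult spinors quotient
      contract_chi3[of chi1] contract_chi3[of chi2] contract_def[symmetric] gconst_simps(6)[symmetric]
    by (simp only: mult.assoc)
qed

end
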